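(* Let $\lambda,\mu,\nu>0$, $K\in\mathbb{N}$ with $K\ge 1$, $T>0$, and $\Sigma_K=\{(w,x,y,z)\in\mathbb{N}^4 : w+x+y+z\le K\}$. For every $(w,x,y,z)\in\Sigma_K$, the system of equations, for $0\le t\le T$, $$\overline{R^r}(t)=w+\iint_{[0,t]\times\mathbb{R}_+}\mathbf{1}_{\{0\le h\le \mathbf{1}_{\{\overline{S}(s^-)<K\}}\mathbb{P}(\overline{V}(s^-)>0)\}}\,\overline{\mathcal N}_{\lambda,1}(ds,dh)-\iint_{[0,t]\times\mathbb{R}_+}\mathbf{1}_{\{0\le h\le \overline{R^r}(s^-)\}}\,\overline{\mathcal N}_{\nu,1}(ds,dh),$$ $$\overline{R}(t)=x+\iint_{[0,t]\times\mathbb{R}_+}\mathbf{1}_{\{0\le h\le \overline{R^r}(s^-)\}}\,\overline{\mathcal N}_{\nu,1}(ds,dh)-\int_0^t\sum_{l=1}^{+\infty}\mathbf{1}_{\{l\le \overline{R}(s^-)\}}\,\mathcal N_{\mu,l}(ds),$$ $$\overline{V}(t)=y+\int_0^t\sum_{l=1}^{+\infty}\mathbf{1}_{\{l\le \overline{R}(s^-)\}}\,\mathcal N_{\mu,l}(ds)-\iint_{[0,t]\times\mathbb{R}_+}\mathbf{1}_{\{0\le h\le \mathbf{1}_{\{\overline{V}(s^-)>0\}}\mathbb{P}(\overline{S}(s^-)<K)\}}\,\overline{\mathcal N}_{\lambda,2}(ds,dh),$$ $$\overline{V^r}(t)=z+\iint_{[0,t]\times\mathbb{R}_+}\mathbf{1}_{\{0\le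 h\le \mathbf{1}_{\{\overline{V}(s^-)>0\}}\mathbb{P}(\overline{S}(s^-)<K)\}}\,\overline{\mathcal N}_{\lambda,2}(ds,dh)-\iint_{[0,t]\times\mathbb{R}_+}\mathbf{1}_{\{0\le h\le \overline{V^r}(s^-)\}}\,\overline{\mathcal N}_{\nu,2}(ds,dh),$$ where $\overline{S}(t)=\overline{R^r}(t)+\overline{R}(t)+\overline{V}(t)+\overline{V^r}(t)$, has a unique solution $(\overline{R^r}(t),\overline{R}(t),\overline{V}(t),\overline{V^r}(t))_{0\le t\le T}$ with sample paths in the space $\mathcal{D}([0,T],\Sigma_K)$ of càdlàg functions from $[0,T]$ to $\Sigma_K$.
   Context: $\mathbb{N}=\{0,1,2,\dots\}$. On a common probability space, the following point processes are mutually independent: $\overline{\mathcal N}_{\lambda,1}$ and $\overline{\mathcal N}_{\lambda,2}$ are Poisson point processes on $\mathbb{R}_+^2$ with intensity $\lambda\,dt\,dh$; $\overline{\mathcal N}_{\nu,1}$ and $\overline{\mathcal N}_{\nu,2}$ are Poisson point processes on $\mathbb{R}_+^2$ with intensity $\nu\,dt\,dh$; and $(\mathcal N_{\mu,l})_{l\ge1}$ is a sequence of Poisson processes on $\mathbb{R}_+$ with rate $\mu$. For a function $f$, $f(s^-)$ is its left limit at $s$. The equations are of McKean--Vlasov type: the probabilities $\mathbb{P}(\overline V(s^-)>0)$ and $\mathbb{P}(\overline S(s^-)<K)$ are computed under the law of the solution itself. As usual for stochastic equations driven by Poisson processes, a solution is a process adapted to the filtration generated by the driving point processes, and uniqueness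 is up to indistinguishability. *)

theory Defs
  imports "HOL-Probability.Probability"
begin

section \<open>Point processes\<close>

text \<open>
  A point process is a random locally finite counting measure. The state space is the one of the
  intensity measure \<open>\<Lambda>\<close>, e.g. the quarter plane when \<open>\<Lambda>\<close> is Lebesgue measure
  restricted to it.
\<close>

definition point_process ::
  "'w measure \<Rightarrow> ('e::metric_space) measure \<Rightarrow> ('w \<Rightarrow> 'e measure) \<Rightarrow> bool" where
  "point_process M \<Lambda> N \<longleftrightarrow>
     (\<forall>\<omega>\<in>space M. sets (N \<omega>) = sets \<Lambda> \<and>
        (\<forall>B\<in>sets \<Lambda>. bounded B \<longrightarrow> (\<exists>n::nat. emeasure (N \<omega>) B = of_nat n))) \<and>
     (\<forall>B\<in>sets \<Lambda>. (\<lambda>\<omega>. emeasure (N \<omega>) B) \<in> borel_measurable M)"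

text \<open>
  The Poisson weights are written out instead of using \<^const>\<open>poisson_pmf\<close>, which is only specified
  for a positive parameter, whereas sets of measure zero have to be covered.
\<close>

definition poisson_point_process ::
  "'w measure \<Rightarrow> ('e::metric_space) measure \<Rightarrow> ('w \<Rightarrow> 'e measure) \<Rightarrow> bool" where
  "poisson_point_process M \<Lambda> N \<longleftrightarrow>
     point_process M \<Lambda> N \<and>
     (\<forall>B\<in>sets \<Lambda>. emeasure \<Lambda> B < \<infinity> \<longrightarrow>
        (\<forall>n::nat. measure M {\<omega>\<in>space M. emeasure (N \<omega>) B = of_nat n}
                   = measure \<Lambda> B ^ n / fact n * exp (- measure \<Lambda> B))) \<and>
     (\<forall>(B::nat \<Rightarrow> 'e set) n. (\<forall>i<n. B i \<in> sets \<Lambda>) \<and> disjoint_family_on B {..<n} \<longrightarrow>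
        prob_space.indep_vars M (\<lambda>_. borel) (\<lambda>i \<omega>. emeasure (N \<omega>) (B i)) {..<n})"

definition pp_events ::
  "'w measure \<Rightarrow> ('w \<Rightarrow> 'e measure) \<Rightarrow> 'e set set \<Rightarrow> 'w set set" where
  "pp_events M N \<B> =
     {(\<lambda>\<omega>. emeasure (N \<omega>) B) -` A \<inter> space M | B A. B \<in> \<B> \<and> A \<in> sets borel}"

definition half_line :: "real \<Rightarrow> real measure" where
  "half_line c = scale_measure (ennreal c) (restrict_space lborel {0..})"

definition quarter_plane :: "real \<Rightarrow> (real \<times> real) measure" where
  "quarter_plane c = scale_measure (ennreal c) (restrict_space lborel ({0..} \<times> {0..}))"


section \<open>The driving processes\<close>

text \<open>
  The processes on the quarter plane are \<open>Nlam 1\<close>, \<open>Nlam 2\<close>, \<open>Nnu 1\<close>, \<open>Nnu 2\<close>, and those on the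
  half line are \<open>Nmu l\<close> with \<open>l \<ge> 1\<close>; other indices play no role.
\<close>

datatype driver = Lam nat | Nu nat | Mu nat

definition drivers :: "driver set" where
  "drivers = Lam ` {1, 2} \<union> Nu ` {1, 2} \<union> Mu ` {1..}"

fun driver_events ::
  "'w measure \<Rightarrow> (nat \<Rightarrow> 'w \<Rightarrow> (real \<times> real) measure) \<Rightarrow> (nat \<Rightarrow> 'w \<Rightarrow> (real \<times> real) measure) \<Rightarrow>
   (nat \<Rightarrow> 'w \<Rightarrow> real measure) \<Rightarrow> real set \<Rightarrow> driver \<Rightarrow> 'w set set" where
  "driver_events M Nlam Nnu Nmu I (Lam i) =
     pp_events M (Nlam i) {B \<in> sets borel. B \<subseteq> I \<times> {0..}}"
| "driver_events M Nlam Nnu Nmu I (Nu i) =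
     pp_events M (Nnu i) {B \<in> sets borel. B \<subseteq> I \<times> {0..}}"
| "driver_events M Nlam Nnu Nmu I (Mu l) =
     pp_events M (Nmu l) {B \<in> sets borel. B \<subseteq> I}"

definition driving_processes ::
  "'w measure \<Rightarrow> (nat \<Rightarrow> 'w \<Rightarrow> (real \<times> real) measure) \<Rightarrow> (nat \<Rightarrow> 'w \<Rightarrow> (real \<times> real) measure) \<Rightarrow>
   (nat \<Rightarrow> 'w \<Rightarrow> real measure) \<Rightarrow> real \<Rightarrow> real \<Rightarrow> real \<Rightarrow> bool" where
  "driving_processes M Nlam Nnu Nmu lam nu mu \<longleftrightarrow>
     (\<forall>i\<in>{1, 2}. poisson_point_process M (quarter_plane lam) (Nlam i)) \<and>
     (\<forall>i\<in>{1, 2}. poisson_point_process M (quarter_plane nu) (Nnu i)) \<and>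
     (\<forall>l\<ge>1. poisson_point_process M (half_line mu) (Nmu l)) \<and>
     prob_space.indep_sets M
       (\<lambda>d. sigma_sets (space M) (driver_events M Nlam Nnu Nmu {0..} d)) drivers"

definition driving_filtration ::
  "'w measure \<Rightarrow> (nat \<Rightarrow> 'w \<Rightarrow> (real \<times> real) measure) \<Rightarrow> (nat \<Rightarrow> 'w \<Rightarrow> (real \<times> real) measure) \<Rightarrow>
   (nat \<Rightarrow> 'w \<Rightarrow> real measure) \<Rightarrow> real \<Rightarrow> 'w measure" where
  "driving_filtration M Nlam Nnu Nmu t =
     sigma (space M) (\<Union>d\<in>drivers. driver_events M Nlam Nnu Nmu {0..t} d)"


section \<open>The equations\<close>

text \<open>States are tuples \<open>(R\<^sup>r, R, V, V\<^sup>r)\<close>.\<close>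

type_synonym state = "nat \<times> nat \<times> nat \<times> nat"

definition Sigma_K :: "nat \<Rightarrow> state set" where
  "Sigma_K K = {(w, x, y, z). w + x + y + z \<le> K}"

text \<open>
  Left limits automatically lie in \<open>E\<close> when \<open>E\<close> is closed, as is every set of states
  (the topology of \<^typ>\<open>state\<close> is discrete).
\<close>

definition cadlag_paths :: "real \<Rightarrow> 'a::topological_space set \<Rightarrow> (real \<Rightarrow> 'a) set" where
  "cadlag_paths T E = {f. (\<forall>t\<in>{0..T}. f t \<in> E) \<and>
     (\<forall>t\<in>{0..<T}. (f \<longlongrightarrow> f t) (at_right t)) \<and>
     (\<forall>t\<in>{0<..T}. \<exists>l. (f \<longlongrightarrow> l) (at_left t))}"

text \<open>
  At time 0 we use the convention \<open>f(0-) = f(0)\<close>; it is immaterial because the driving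
  processes almost surely have no point with time coordinate 0.
\<close>

definition left_lim :: "(real \<Rightarrow> 'a::t2_space) \<Rightarrow> real \<Rightarrow> 'a" where
  "left_lim f s = (if s = 0 then f 0 else Lim (at_left s) f)"

text \<open>The integral of \<open>1{0 \<le> h \<le> \<theta>(s)}\<close> over \<open>[0,t] \<times> \<real>\<^sub>+\<close> with respect to \<open>N(ds, dh)\<close>.\<close>

definition thinned_count :: "(real \<times> real) measure \<Rightarrow> (real \<Rightarrow> real) \<Rightarrow> real \<Rightarrow> real" where
  "thinned_count N \<theta> t =
     set_lebesgue_integral N ({0..t} \<times> {0..}) (\<lambda>(s, h). of_bool (0 \<le> h \<and> h \<le> \<theta> s))"

text \<open>
  The integral over \<open>[0,t]\<close> of the series over \<open>l \<ge> 1\<close> of \<open>1{l \<le> \<rho>(s)} N\<^sub>l(ds)\<close>. Only finitely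
  many terms are nonzero when \<open>\<rho>\<close> is bounded.
\<close>

definition server_count :: "(nat \<Rightarrow> real measure) \<Rightarrow> (real \<Rightarrow> nat) \<Rightarrow> real \<Rightarrow> real" where
  "server_count N \<rho> t =
     (\<Sum>\<^sub>\<infinity>l\<in>{1..}. set_lebesgue_integral (N l) {0..t} (\<lambda>s. of_bool (l \<le> \<rho> s)))"

definition solves_system ::
  "'w measure \<Rightarrow> (nat \<Rightarrow> 'w \<Rightarrow> (real \<times> real) measure) \<Rightarrow> (nat \<Rightarrow> 'w \<Rightarrow> (real \<times> real) measure) \<Rightarrow>
   (nat \<Rightarrow> 'w \<Rightarrow> real measure) \<Rightarrow> nat \<Rightarrow> real \<Rightarrow> state \<Rightarrow>
   (real \<Rightarrow> 'w \<Rightarrow> nat) \<Rightarrow> (real \<Rightarrow> 'w \<Rightarrow> nat) \<Rightarrow> (real \<Rightarrow> 'w \<Rightarrow> nat) \<Rightarrow> (real \<Rightarrow> 'w \<Rightarrow> nat) \<Rightarrow> bool" where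
  "solves_system M Nlam Nnu Nmu K T init Rr R V Vr \<longleftrightarrow>
   (case init of (w, x, y, z) \<Rightarrow>
     let S = (\<lambda>t \<omega>. Rr t \<omega> + R t \<omega> + V t \<omega> + Vr t \<omega>);
         Rr' = (\<lambda>\<omega>. left_lim (\<lambda>u. Rr u \<omega>));
         R' = (\<lambda>\<omega>. left_lim (\<lambda>u. R u \<omega>));
         V' = (\<lambda>\<omega>. left_lim (\<lambda>u. V u \<omega>));
         Vr' = (\<lambda>\<omega>. left_lim (\<lambda>u. Vr u \<omega>));
         S' = (\<lambda>\<omega>. left_lim (\<lambda>u. S u \<omega>));
         pV = (\<lambda>s. measure M {\<omega>\<in>space M. V' \<omega> s > 0});
         pS = (\<lambda>s. measure M {\<omega>\<in>space M. S' \<omega> s < K})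
     in AE \<omega> in M. \<forall>t\<in>{0..T}.
       real (Rr t \<omega>) = real w
         + thinned_count (Nlam 1 \<omega>) (\<lambda>s. of_bool (S' \<omega> s < K) * pV s) t
         - thinned_count (Nnu 1 \<omega>) (\<lambda>s. real (Rr' \<omega> s)) t \<and>
       real (R t \<omega>) = real x
         + thinned_count (Nnu 1 \<omega>) (\<lambda>s. real (Rr' \<omega> s)) t
         - server_count (\<lambda>l. Nmu l \<omega>) (R' \<omega>) t \<and>
       real (V t \<omega>) = real y
         + server_count (\<lambda>l. Nmu l \<omega>) (R' \<omega>) t
         - thinned_count (Nlam 2 \<omega>) (\<lambda>s. of_bool (V' \<omega> s > 0) * pS s) t \<and>
       real (Vr t \<omega>) = real z
         + thinned_count (Nlam 2 \<omega>) (\<lambda>s. of_bool (V' \<omega> s > 0) * pS s) t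
         - thinned_count (Nnu 2 \<omega>) (\<lambda>s. real (Vr' \<omega> s)) t)"

text \<open>
  A solution is adapted to the filtration generated by the driving processes, has all its sample
  paths in the Skorokhod space, and satisfies the equations almost surely for all times.
\<close>

definition is_solution ::
  "'w measure \<Rightarrow> (nat \<Rightarrow> 'w \<Rightarrow> (real \<times> real) measure) \<Rightarrow> (nat \<Rightarrow> 'w \<Rightarrow> (real \<times> real) measure) \<Rightarrow>
   (nat \<Rightarrow> 'w \<Rightarrow> real measure) \<Rightarrow> nat \<Rightarrow> real \<Rightarrow> state \<Rightarrow> (real \<Rightarrow> 'w \<Rightarrow> state) \<Rightarrow> bool" where
  "is_solution M Nlam Nnu Nmu K T init X \<longleftrightarrow>
     (\<forall>t\<in>{0..T}. X t \<in> driving_filtration M Nlam Nnu Nmu t \<rightarrow>\<^sub>M count_space UNIV) \<and>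
     (\<forall>\<omega>\<in>space M. (\<lambda>t. X t \<omega>) \<in> cadlag_paths T (Sigma_K K)) \<and>
     solves_system M Nlam Nnu Nmu K T init
       (\<lambda>t \<omega>. fst (X t \<omega>)) (\<lambda>t \<omega>. fst (snd (X t \<omega>)))
       (\<lambda>t \<omega>. fst (snd (snd (X t \<omega>)))) (\<lambda>t \<omega>. snd (snd (snd (X t \<omega>))))"

definition indistinguishable ::
  "'w measure \<Rightarrow> real \<Rightarrow> (real \<Rightarrow> 'w \<Rightarrow> 'a) \<Rightarrow> (real \<Rightarrow> 'w \<Rightarrow> 'a) \<Rightarrow> bool" where
  "indistinguishable M T X Y \<longleftrightarrow> (AE \<omega> in M. \<forall>t\<in>{0..T}. X t \<omega> = Y t \<omega>)"

end

theory Submission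
  imports Defs
begin

text \<open>
  For given acceptance probabilities \<open>p = (P(V(s-) > 0), P(S(s-) < K))\<close> the system is solved path by
  path: on \<open>[0, T]\<close> only finitely many points matter, and almost surely no two of them are
  simultaneous. If \<open>X\<close> and \<open>Y\<close> solve the system for \<open>p\<close> and \<open>q\<close>, they can only separate at a point of
  one of the first two processes whose height lies between \<open>p\<close> and \<open>q\<close>. This region is deterministic, so
  \<open>X\<close> and \<open>Y\<close> differ somewhere on \<open>[0, t]\<close> with probability at most \<open>\<lambda>\<close> times its area. Hence the map
  from \<open>p\<close> to the probabilities computed from the solution is a contraction by \<open>1/2\<close> for the supremum
  norm weighted by \<open>exp (- 4 \<lambda> s)\<close>, and its unique fixed point gives the unique solution of the
  McKean--Vlasov system.
\<close>

section \<open>Integer-valued measures\<close>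

text \<open>The obstacle is that a solution must be adapted to the uncompleted filtration and must
  have every path in the state space, whereas point configurations behave well only almost surely.
  The process is therefore built for every outcome: \<open>update\<close> ignores impossible jumps,
  and a time discretisation that is eventually exact expresses the path through counts of
  deterministic sets. Null sets enter only when the equations are verified. All rates are at most
  \<open>K\<close>, so only points in \<open>{0..T} \<times> {0..real K}\<close> count, and there an
  integer-valued measure is concentrated on finitely many times. Origin of \<open>4 * lam\<close>:
  integrating \<open>C * exp (4 * lam * s)\<close> gives at most
  \<open>C * exp (4 * lam * t) / (4 * lam)\<close>; each of the two arrival processes contributes
  \<open>lam\<close> times this, which adds up to the factor \<open>1/2\<close>. In place of a
  complete function space, Picard iterates are shown to converge pointwise at geometric speed, which
  also makes the limit measurable.\<close>

lemma integer_measure_null_if_no_atoms: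
  fixes N :: "real measure"
  assumes "finite_borel_measure N"
    and int: "\<And>A. A \<in> sets borel \<Longrightarrow> measure N A \<in> \<int>"
    and no_atoms: "\<And>x. measure N {x} = 0"
  shows "measure N (space N) = 0"
proof -
  interpret finite_borel_measure N by fact
  have cont: "continuous_on UNIV (cdf N)"
    using no_atoms isCont_cdf by (simp add: continuous_on_eq_continuous_at)
  \<comment> \<open>Without atoms the distribution function is continuous, and its values differ by
    integers, so connectedness of the line forces it to be constant; the limit at minus infinity
    then fixes the constant as \<open>0\<close>.\<close>
  have "cdf N constant_on UNIV"
  proof (rule continuous_discrete_range_constant[OF connected_UNIV cont])
    fix x :: real
    show "\<exists>e>0. \<forall>y. y \<in> UNIV \<and> cdf N y \<noteq> cdf N x \<longrightarrow> e \<le> norm (cdf N y - cdf N x)"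
    proof (intro exI[of _ 1] conjI allI impI)
      fix y assume "y \<in> UNIV \<and> cdf N y \<noteq> cdf N x"
      moreover have "cdf N y - cdf N x \<in> \<int>"
        using int by (auto simp: cdf_def intro: Ints_diff)
      ultimately show "1 \<le> norm (cdf N y - cdf N x)"
        using Ints_nonzero_abs_ge1[of "cdf N y - cdf N x"] by auto
    qed simp
  qed
  then obtain c where c: "cdf N = (\<lambda>_. c)" by (auto simp: constant_on_def fun_eq_iff)
  have "c = 0"
    using cdf_lim_at_bot by (simp add: c tendsto_const_iff)
  moreover have "measure N (space N) = c"
    using cdf_lim_at_top by (simp add: c tendsto_const_iff)
  ultimately show ?thesis by simp
qed

text \<open>A point process is only required to take integer values on bounded sets, so its points
  have to be recovered as atoms. Each atom has mass at least \<open>1\<close>, hence the total mass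
  bounds their number; removing them leaves an integer-valued measure without atoms, which
  vanishes.\<close>

lemma integer_measure_atoms:
  fixes N :: "real measure"
  assumes "finite_borel_measure N"
    and int: "\<And>A. A \<in> sets borel \<Longrightarrow> measure N A \<in> \<int>"
  defines "J \<equiv> {x. measure N {x} \<noteq> 0}"
  shows "finite J" and "measure N (- J) = 0"
proof -
  interpret finite_borel_measure N by fact
  have ge1: "1 \<le> measure N {x}" if "x \<in> J" for x
    using that int[of "{x}"] Ints_nonzero_abs_ge1[of "measure N {x}"] by (auto simp: J_def)
  show fin: "finite J"
  proof (rule ccontr)
    assume "infinite J"
    then obtain F where F: "F \<subseteq> J" "finite F" "card F = nat \<lceil>measure N (space N)\<rceil> + 1"
      using infinite_arbitrarily_large by blast
    have "real (card F) \<le> (\<Sum>x\<in>F. measure N {x})"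
      using sum_mono[of F "\<lambda>_. 1" "\<lambda>x. measure N {x}"] ge1 F by auto
    also have "\<dots> = measure N F"
      using F by (subst finite_measure_eq_sum_singleton) auto
    also have "\<dots> \<le> measure N (space N)" by (rule bounded_measure)
    finally show False using F by linarith
  qed
  have J: "J \<in> sets borel" using fin by (simp add: finite_imp_closed borel_closed)
  let ?N = "density N (indicator (- J))"
  have em: "emeasure ?N A = emeasure N (- J \<inter> A)" if "A \<in> sets borel" for A
    using that J by (subst emeasure_restricted) auto
  have me: "measure ?N A = measure N (- J \<inter> A)" if "A \<in> sets borel" for A
    using em[OF that] by (simp add: measure_def)
  have "measure ?N (space ?N) = 0"
  proof (rule integer_measure_null_if_no_atoms)
    show "finite_borel_measure ?N"
      using J finite_measure_restricted[of "- J"]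
      by (intro finite_borel_measure.intro finite_borel_measure_axioms.intro) (simp_all add: M_is_borel)
    show "measure ?N A \<in> \<int>" if "A \<in> sets borel" for A
      unfolding me[OF that] using J that by (intro int) simp
    show "measure ?N {x} = 0" for x
      proof -
      have "- J \<inter> {x} = (if x \<in> J then {} else {x})" by auto
      then show ?thesis unfolding me[OF borel_singleton[OF sets.empty_sets]] by (simp add: J_def)
    qed
  qed
  then show "measure N (- J) = 0" using me[of UNIV] by (simp add: borel_UNIV)
qed

section \<open>Point configurations in a box\<close>

text \<open>States in \<open>Sigma_K K\<close> have second coordinate at most \<open>K\<close>, so
  no point of \<open>Mu l\<close> with \<open>l > K\<close> is ever accepted and finitely many
  drivers suffice.\<close>

definition active :: "nat \<Rightarrow> driver set" where
  "active K = {Lam 1, Lam 2, Nu 1, Nu 2} \<union> Mu ` {1..K}"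

lemma finite_active [simp]: "finite (active K)"
  by (simp add: active_def)

lemma rectangle_borel [simp]:
  fixes A B :: "real set"
  shows "A \<in> sets borel \<Longrightarrow> B \<in> sets borel \<Longrightarrow> A \<times> B \<in> sets borel"
  unfolding borel_prod[symmetric] by (rule pair_measureI)

text \<open>
  All drivers are regarded as measures on the plane. The points of \<^term>\<open>Mu l\<close> are placed at height
  \<open>1\<close>, so that the threshold \<open>1{l \<le> R(s-)}\<close> decides about their acceptance as for the other drivers.
\<close>

locale configuration =
  fixes Q :: "driver \<Rightarrow> (real \<times> real) measure" and K :: nat and T :: real
  assumes K_pos: "K \<ge> 1"
    and sets_Q: "d \<in> active K \<Longrightarrow> sets (Q d) = sets borel"
    and nat_Q: "d \<in> active K \<Longrightarrow> B \<in> sets borel \<Longrightarrow> B \<subseteq> {0..T} \<times> {0..real K} \<Longrightarrow>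
      \<exists>n::nat. emeasure (Q d) B = of_nat n"
begin

text \<open>Counts live in \<open>nat\<close> so that transitions can be stated without extended
  reals. The rounding is exact on Borel subsets of \<open>box\<close>.\<close>

definition cnt :: "driver \<Rightarrow> (real \<times> real) set \<Rightarrow> nat" where
  "cnt d B = nat \<lfloor>measure (Q d) B\<rfloor>"

text \<open>Time \<open>0\<close> is excluded because the left limit there is a convention; points
  at that time are ruled out almost surely by \<open>AE_no_point_at_0\<close>.\<close>

definition events :: "real set" where
  "events = {s \<in> {0<..T}. \<exists>d\<in>active K. measure (Q d) ({s} \<times> {0..real K}) \<noteq> 0}"

abbreviation box :: "(real \<times> real) set" where
  "box \<equiv> {0..T} \<times> {0..real K}"

lemma emeasure_cnt:
  assumes "d \<in> active K" "B \<in> sets borel" "B \<subseteq> box"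
  shows "emeasure (Q d) B = ennreal (real (cnt d B))"
proof -
  obtain n :: nat where n: "emeasure (Q d) B = of_nat n"
    using nat_Q assms by blast
  then have "measure (Q d) B = real n" by (simp add: measure_def enn2real_of_nat)
  with n show ?thesis by (simp add: cnt_def ennreal_of_nat_eq_real_of_nat)
qed

lemma measure_cnt:
  assumes "d \<in> active K" "B \<in> sets borel" "B \<subseteq> box"
  shows "measure (Q d) B = real (cnt d B)"
  using emeasure_cnt[OF assms] by (simp add: measure_def)

lemma cnt_mono:
  assumes "d \<in> active K" "A \<in> sets borel" "B \<in> sets borel" "A \<subseteq> B" "B \<subseteq> box"
  shows "cnt d A \<le> cnt d B"
proof -
  have "emeasure (Q d) A \<le> emeasure (Q d) B"
    using assms sets_Q by (intro emeasure_mono) auto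
  moreover have "A \<subseteq> box" using assms by blast
  ultimately show ?thesis using emeasure_cnt assms by simp
qed

lemma cnt_empty [simp]: "cnt d {} = 0" by (simp add: cnt_def)

lemma cnt_Un:
  assumes "d \<in> active K" "A \<in> sets borel" "B \<in> sets borel" "A \<inter> B = {}" "A \<subseteq> box" "B \<subseteq> box"
  shows "cnt d (A \<union> B) = cnt d A + cnt d B"
proof -
  have "emeasure (Q d) (A \<union> B) = emeasure (Q d) A + emeasure (Q d) B"
    using assms sets_Q by (intro plus_emeasure[symmetric]) auto
  then have "ennreal (real (cnt d (A \<union> B))) = ennreal (real (cnt d A + cnt d B))"
    using assms by (simp add: emeasure_cnt)
  then show ?thesis by (simp only: ennreal_inj of_nat_0_le_iff of_nat_eq_iff)
qed

lemma cnt_UN: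
  assumes "d \<in> active K" "finite I" "\<And>i. i \<in> I \<Longrightarrow> A i \<in> sets borel" "disjoint_family_on A I"
    "\<And>i. i \<in> I \<Longrightarrow> A i \<subseteq> box"
  shows "cnt d (\<Union>i\<in>I. A i) = (\<Sum>i\<in>I. cnt d (A i))"
  using assms(2-)
proof (induction I)
  case (insert i I)
  have 1: "(\<Union>i\<in>I. A i) \<in> sets borel" using insert by auto
  have 2: "A i \<inter> (\<Union>i\<in>I. A i) = {}"
    using insert.prems(2) insert.hyps by (auto simp: disjoint_family_on_def)
  have 3: "disjoint_family_on A I"
    using insert.prems(2) by (auto simp: disjoint_family_on_def)
  have 4: "(\<Union>i\<in>I. A i) \<subseteq> box" using insert.prems(3) by blast
  have "cnt d (A i \<union> (\<Union>i\<in>I. A i)) = cnt d (A i) + cnt d (\<Union>i\<in>I. A i)"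
    using insert.prems 1 2 4 by (intro cnt_Un[OF assms(1)]) auto
  moreover have "cnt d (\<Union>i\<in>I. A i) = (\<Sum>i\<in>I. cnt d (A i))"
    using insert.prems 3 by (intro insert.IH) auto
  ultimately show ?case using insert.hyps by simp
qed simp

text \<open>\<open>E\<close> will be a band or a time slice without points: removing it changes
  neither count and makes the two sets equal.\<close>

lemma cnt_eq_up_to_null:
  assumes d: "d \<in> active K" and A: "A \<in> sets borel" "A \<subseteq> box" and B: "B \<in> sets borel" "B \<subseteq> box"
    and E: "E \<in> sets borel" "E \<subseteq> box" "cnt d E = 0" and sub: "A - B \<subseteq> E" "B - A \<subseteq> E"
  shows "cnt d A = cnt d B"
proof -
  have *: "cnt d C = cnt d (C - E)" if C: "C \<in> sets borel" "C \<subseteq> box" for C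
  proof -
    have "C = (C - E) \<union> (C \<inter> E)" by blast
    then have "cnt d C = cnt d ((C - E) \<union> (C \<inter> E))" by simp
    also have "\<dots> = cnt d (C - E) + cnt d (C \<inter> E)"
    proof (rule cnt_Un[OF d])
      show "C - E \<in> sets borel" "C \<inter> E \<in> sets borel" using C E by auto
      show "C - E \<subseteq> box" "C \<inter> E \<subseteq> box" using C by blast+
    qed blast
    also have "cnt d (C \<inter> E) \<le> cnt d E"
      using C E by (intro cnt_mono[OF d]) blast+
    then have "cnt d (C \<inter> E) = 0" using E by simp
    finally show ?thesis by simp
  qed
  have "A - E = B - E" using sub by blast
  then show ?thesis using *[OF A] *[OF B] by simp
qed

text \<open>The driver restricted to \<open>box\<close> is projected to the time axis, where
  \<open>integer_measure_atoms\<close> applies. The second claim is what turns an integral into a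
  finite sum over times.\<close>

lemma finite_atoms_driver:
  assumes d: "d \<in> active K"
  defines "J \<equiv> {s. cnt d (box \<inter> {s} \<times> UNIV) \<noteq> 0}"
  shows "finite J" and "cnt d (box \<inter> (- J) \<times> UNIV) = 0"
proof -
  let ?R = "density (Q d) (indicator box)"
  let ?N = "distr ?R borel fst"
  have bb: "box \<in> sets borel" by simp
  have vim: "fst -` A = A \<times> (UNIV :: real set)" for A :: "real set" by auto
  have em: "emeasure ?N A = emeasure (Q d) (box \<inter> A \<times> UNIV)" if A: "A \<in> sets borel" for A
  proof -
    have "(fst :: real \<times> real \<Rightarrow> real) \<in> borel_measurable borel"
      unfolding borel_prod[symmetric] by (rule measurable_fst)
    then have "fst \<in> ?R \<rightarrow>\<^sub>M (borel :: real measure)"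
      using sets_Q[OF d] by (simp cong: measurable_cong_sets)
    then have "emeasure ?N A = emeasure ?R (A \<times> UNIV)"
      using A sets_eq_imp_space_eq[OF sets_Q[OF d]] by (simp add: emeasure_distr vim)
    also have "\<dots> = emeasure (Q d) (box \<inter> A \<times> UNIV)"
      using A sets_Q[OF d] by (intro emeasure_restricted) simp_all
    finally show ?thesis .
  qed
  have me: "measure ?N A = real (cnt d (box \<inter> A \<times> UNIV))" if A: "A \<in> sets borel" for A
  proof -
    have "box \<inter> A \<times> UNIV \<in> sets borel" using A by (intro sets.Int) simp_all
    moreover have "box \<inter> A \<times> UNIV \<subseteq> box" by blast
    ultimately show ?thesis
      unfolding measure_def[of ?N] em[OF A] by (simp add: emeasure_cnt[OF d] del: Sigma_Int_distrib1)
  qed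
  have fbm: "finite_borel_measure ?N"
  proof (intro finite_borel_measure.intro finite_borel_measure_axioms.intro finite_measureI)
    have "box \<inter> UNIV \<times> UNIV = box" by blast
    then show "emeasure ?N (space ?N) \<noteq> \<infinity>"
      using em[of UNIV] by (simp add: emeasure_cnt[OF d])
  qed simp
  have int: "measure ?N A \<in> \<int>" if "A \<in> sets borel" for A using me[OF that] by simp
  have J: "J = {x. measure ?N {x} \<noteq> 0}"
    by (simp add: J_def me)
  show fin: "finite J" using integer_measure_atoms(1)[OF fbm int] J by simp
  have "- J \<in> sets borel" using fin by (simp add: finite_imp_closed borel_closed)
  then show "cnt d (box \<inter> (- J) \<times> UNIV) = 0"
    using integer_measure_atoms(2)[OF fbm int] J me[of "- J"] by simp
qed

lemma box_slice: "0 \<le> s \<Longrightarrow> s \<le> T \<Longrightarrow> box \<inter> {s} \<times> UNIV = {s} \<times> {0..real K}"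
  by auto

lemma events_iff:
  "s \<in> events \<longleftrightarrow> s \<in> {0<..T} \<and> (\<exists>d\<in>active K. cnt d (box \<inter> {s} \<times> UNIV) \<noteq> 0)"
proof (cases "s \<in> {0<..T}")
  case True
  then have "{s} \<times> {0..real K} \<subseteq> box" by auto
  then show ?thesis
    using True by (auto simp: events_def box_slice measure_cnt simp del: Times_Int_Times)
qed (auto simp: events_def)

lemma finite_events [simp]: "finite events"
proof -
  have "events \<subseteq> (\<Union>d\<in>active K. {s. cnt d (box \<inter> {s} \<times> UNIV) \<noteq> 0})"
    using events_iff by blast
  moreover have "finite \<dots>" by (intro finite_UN_I finite_active finite_atoms_driver(1))
  ultimately show ?thesis by (rule finite_subset)
qed

lemma events_borel: "events \<in> sets borel"
  by (simp add: finite_imp_closed borel_closed)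

lemma events_subset: "events \<subseteq> {0<..T}"
  by (auto simp: events_def)

text \<open>\<open>events\<close> contains the atoms in \<open>{0<..T}\<close> of every active
  driver, in particular those of \<open>d\<close>; the slices at events of other drivers add
  \<open>0\<close>, and the part outside all slices is null by
  \<open>finite_atoms_driver\<close>.\<close>

lemma cnt_decomp:
  assumes d: "d \<in> active K" and B: "B \<in> sets borel" "B \<subseteq> {0<..T} \<times> {0..real K}"
  shows "cnt d B = (\<Sum>s\<in>events. cnt d (B \<inter> {s} \<times> UNIV))"
proof -
  let ?J = "{s. cnt d (box \<inter> {s} \<times> UNIV) \<noteq> 0}"
  have Bb: "B \<subseteq> box" using B by fastforce
  let ?B1 = "B - events \<times> UNIV" and ?B2 = "B \<inter> events \<times> UNIV"
  have ev: "events \<times> (UNIV :: real set) \<in> sets borel"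
    using events_borel by simp
  have JU: "box \<inter> (- ?J) \<times> (UNIV :: real set) \<in> sets borel"
  proof -
    have "- ?J \<in> sets borel"
      using finite_atoms_driver(1)[OF d] by (intro borel_open open_Compl finite_imp_closed)
    then show ?thesis by (intro sets.Int rectangle_borel) simp_all
  qed
  have "?B1 \<subseteq> box \<inter> (- ?J) \<times> UNIV"
  proof
    fix v assume v: "v \<in> ?B1"
    then have "fst v \<in> {0<..T}" "fst v \<notin> events" using B by auto
    then have "fst v \<notin> ?J" using d events_iff by blast
    then show "v \<in> box \<inter> (- ?J) \<times> UNIV" using v Bb by (cases v) auto
  qed
  then have "cnt d ?B1 \<le> cnt d (box \<inter> (- ?J) \<times> UNIV)"
    using B ev JU by (intro cnt_mono[OF d] sets.Diff) simp_all
  then have 1: "cnt d ?B1 = 0" using finite_atoms_driver(2)[OF d] by simp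
  have "?B2 = (\<Union>s\<in>events. B \<inter> {s} \<times> UNIV)" by auto
  moreover have "cnt d (\<Union>s\<in>events. B \<inter> {s} \<times> UNIV) = (\<Sum>s\<in>events. cnt d (B \<inter> {s} \<times> UNIV))"
  proof (rule cnt_UN[OF d])
    show "B \<inter> {s} \<times> UNIV \<in> sets borel" for s using B by (intro sets.Int) simp_all
    show "B \<inter> {s} \<times> UNIV \<subseteq> box" for s using Bb by blast
    show "disjoint_family_on (\<lambda>s. B \<inter> {s} \<times> UNIV) events" by (auto simp: disjoint_family_on_def)
  qed simp
  ultimately have 2: "cnt d ?B2 = (\<Sum>s\<in>events. cnt d (B \<inter> {s} \<times> UNIV))" by simp
  have "B = ?B1 \<union> ?B2" by blast
  then have "cnt d B = cnt d (?B1 \<union> ?B2)" by simp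
  also have "\<dots> = cnt d ?B1 + cnt d ?B2"
  proof (rule cnt_Un[OF d])
    show "?B1 \<in> sets borel" "?B2 \<in> sets borel" using B ev by auto
    show "?B1 \<subseteq> box" "?B2 \<subseteq> box" using Bb by blast+
  qed blast
  finally show ?thesis using 1 2 by simp
qed

end

section \<open>Transitions\<close>

text \<open>One relation serves both for a single transition, with \<open>c\<close> the counts at
  one time, and for the integral equations, with \<open>c\<close> the counts up to \<open>t\<close>.
  Departures stand on the left-hand side, which avoids truncated subtraction.\<close>

fun balance :: "nat \<Rightarrow> state \<Rightarrow> (driver \<Rightarrow> nat) \<Rightarrow> state \<Rightarrow> bool" where
  "balance K (w, x, y, z) c (w', x', y', z') \<longleftrightarrow>
     w' + c (Nu 1) = w + c (Lam 1) \<and>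
     x' + (\<Sum>l=1..K. c (Mu l)) = x + c (Nu 1) \<and>
     y' + c (Lam 2) = y + (\<Sum>l=1..K. c (Mu l)) \<and>
     z' + c (Nu 2) = z + c (Lam 2)"

lemma balance_unique:
  assumes "balance K x c y" "balance K x c' y'" "\<And>d. d \<in> active K \<Longrightarrow> c d = c' d"
  shows "y = y'"
proof -
  have "(\<Sum>l=1..K. c (Mu l)) = (\<Sum>l=1..K. c' (Mu l))"
    using assms(3) by (intro sum.cong) (auto simp: active_def)
  then show ?thesis
    using assms by (cases x; cases y; cases y') (auto simp: active_def)
qed

lemma balance_cong:
  assumes "\<And>d. d \<in> active K \<Longrightarrow> c d = c' d"
  shows "balance K x c y \<longleftrightarrow> balance K x c' y"
proof -
  have "(\<Sum>l=1..K. c (Mu l)) = (\<Sum>l=1..K. c' (Mu l))"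
    using assms by (intro sum.cong) (auto simp: active_def)
  then show ?thesis
    using assms by (cases x; cases y) (auto simp: active_def)
qed

lemma balance_zero: "(\<And>d. d \<in> active K \<Longrightarrow> c d = 0) \<Longrightarrow> balance K x c x"
  by (cases x) (auto simp: active_def)

lemma balance_trans:
  "balance K x c y \<Longrightarrow> balance K y c' z \<Longrightarrow> balance K x (\<lambda>d. c d + c' d) z"
  by (cases x; cases y; cases z) (auto simp: sum.distrib)

text \<open>Transitions that would leave the state space are suppressed; almost surely there are none.\<close>

definition update :: "nat \<Rightarrow> state \<Rightarrow> (driver \<Rightarrow> nat) \<Rightarrow> state" where
  "update K x c = (if \<exists>y\<in>Sigma_K K. balance K x c y then SOME y. y \<in> Sigma_K K \<and> balance K x c y else x)"

lemma update_eq: "y \<in> Sigma_K K \<Longrightarrow> balance K x c y \<Longrightarrow> update K x c = y"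
  unfolding update_def using balance_unique by (smt (verit, best) someI_ex)

lemma update_zero: "x \<in> Sigma_K K \<Longrightarrow> (\<And>d. d \<in> active K \<Longrightarrow> c d = 0) \<Longrightarrow> update K x c = x"
  by (intro update_eq balance_zero)

lemma update_cong: "(\<And>d. d \<in> active K \<Longrightarrow> c d = c' d) \<Longrightarrow> update K x c = update K x c'"
  unfolding update_def using balance_cong[of K c c'] by presburger

lemma update_in: "x \<in> Sigma_K K \<Longrightarrow> update K x c \<in> Sigma_K K"
  unfolding update_def by (auto intro: someI2_bex)

text \<open>The pair \<open>p s\<close> stands for the probabilities of \<open>V > 0\<close> and of
  \<open>S < K\<close> just before \<open>s\<close>, in this order. Every index other than
  \<open>1\<close> is read as \<open>2\<close>; in \<open>active K\<close> only these two
  occur.\<close>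

fun rate :: "nat \<Rightarrow> (real \<Rightarrow> real \<times> real) \<Rightarrow> driver \<Rightarrow> state \<Rightarrow> real \<Rightarrow> real" where
  "rate K p (Lam i) (w, x, y, z) s =
     (if i = 1 then of_bool (w + x + y + z < K) * fst (p s) else of_bool (y > 0) * snd (p s))"
| "rate K p (Nu i) (w, x, y, z) s = (if i = 1 then real w else real z)"
| "rate K p (Mu l) (w, x, y, z) s = of_bool (l \<le> x)"

text \<open>A set of times is allowed because the state is frozen both at a single event and over a
  whole mesh interval of \<open>approx\<close>.\<close>

definition region :: "nat \<Rightarrow> (real \<Rightarrow> real \<times> real) \<Rightarrow> driver \<Rightarrow> state \<Rightarrow> real set \<Rightarrow> (real \<times> real) set" where
  "region K p d x I = {(s, h). s \<in> I \<and> 0 \<le> h \<and> h \<le> rate K p d x s}"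

definition unit_valued :: "(real \<Rightarrow> real \<times> real) \<Rightarrow> bool" where
  "unit_valued p \<longleftrightarrow> (\<forall>s. 0 \<le> fst (p s) \<and> fst (p s) \<le> 1 \<and> 0 \<le> snd (p s) \<and> snd (p s) \<le> 1)"

lemma subgraph_borel:
  fixes g :: "real \<Rightarrow> real"
  assumes [measurable]: "g \<in> borel_measurable borel" "I \<in> sets borel"
  shows "{(s, h). s \<in> I \<and> 0 \<le> h \<and> h \<le> g s} \<in> sets borel"
proof -
  have "{v \<in> space (borel \<Otimes>\<^sub>M borel). fst v \<in> I \<and> 0 \<le> snd v \<and> snd v \<le> g (fst v)}
    \<in> sets (borel \<Otimes>\<^sub>M (borel :: real measure))"
    by measurable
  also have "{v \<in> space (borel \<Otimes>\<^sub>M borel). fst v \<in> I \<and> 0 \<le> snd v \<and> snd v \<le> g (fst v)}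
    = {(s, h). s \<in> I \<and> 0 \<le> h \<and> h \<le> g s}"
    by (auto simp: space_pair_measure)
  finally show ?thesis unfolding borel_prod .
qed

lemma rate_measurable [measurable]:
  assumes [measurable]: "p \<in> borel_measurable borel"
  shows "rate K p d x \<in> borel_measurable borel"
proof -
  obtain w x' y z where x: "x = (w, x', y, z)" by (cases x)
  have 1: "(\<lambda>s. fst (p s)) \<in> borel_measurable borel" "(\<lambda>s. snd (p s)) \<in> borel_measurable borel"
    using assms unfolding borel_prod[symmetric] by simp_all
  show ?thesis
  proof (cases d)
    case (Lam i)
    have "rate K p (Lam i) (w, x', y, z) = (\<lambda>s. if i = 1 then of_bool (w + x' + y + z < K) * fst (p s)
      else of_bool (y > 0) * snd (p s))"
      by (rule ext) simp
    with Lam 1 show ?thesis by (simp add: x)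
  next
    case (Nu i)
    have "rate K p (Nu i) (w, x', y, z) = (\<lambda>s. if i = 1 then real w else real z)"
      by (rule ext) simp
    with Nu show ?thesis by (simp add: x)
  next
    case (Mu l)
    have "rate K p (Mu l) (w, x', y, z) = (\<lambda>s. of_bool (l \<le> x'))"
      by (rule ext) simp
    with Mu show ?thesis by (simp add: x)
  qed
qed

lemma region_borel:
  "p \<in> borel_measurable borel \<Longrightarrow> I \<in> sets borel \<Longrightarrow> region K p d x I \<in> sets borel"
  unfolding region_def by (rule subgraph_borel[OF rate_measurable])

text \<open>The thresholds of \<open>Lam\<close> and \<open>Mu\<close> are at most \<open>1\<close>,
  those of \<open>Nu\<close> at most a coordinate of the state. This is why a box of height
  \<open>K \<ge> 1\<close> sees every accepted point.\<close>

lemma rate_le: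
  assumes "unit_valued p" "K \<ge> 1" "x \<in> Sigma_K K"
  shows "rate K p d x s \<le> real K"
proof -
  obtain w x' y z where x: "x = (w, x', y, z)" by (cases x)
  have 1: "fst (p s) \<le> 1" "snd (p s) \<le> 1" using assms(1) by (auto simp: unit_valued_def)
  have 2: "1 \<le> real K" using assms(2) by simp
  have "w + x' + y + z \<le> K" using assms(3) x by (simp add: Sigma_K_def)
  then show ?thesis unfolding x using 1 2 by (cases d) (auto simp: of_bool_def)
qed

lemma region_subset:
  assumes "unit_valued p" "K \<ge> 1" "x \<in> Sigma_K K" "I \<subseteq> J"
  shows "region K p d x I \<subseteq> J \<times> {0..real K}"
proof -
  have "h \<le> real K" if "h \<le> rate K p d x s" for s h
    using that rate_le[OF assms(1-3), of d s] by linarith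
  then show ?thesis using assms(4) by (auto simp: region_def)
qed

lemma region_slice: "region K p d x I \<inter> {s} \<times> UNIV = (if s \<in> I then region K p d x {s} else {})"
  by (auto simp: region_def)

text \<open>This is where simplicity of the points is used: a single enabled jump respects the state
  space, since a positive rate means a free place or a nonzero component to leave, whereas two
  simultaneous jumps could exceed \<open>K\<close> or empty a component twice.\<close>

lemma single_transition_in:
  assumes x: "x \<in> Sigma_K K" and c: "(\<Sum>d\<in>active K. c d) \<le> 1"
    and enabled: "\<And>d. d \<in> active K \<Longrightarrow> c d \<noteq> 0 \<Longrightarrow> rate K p d x s > 0"
  shows "\<exists>y\<in>Sigma_K K. balance K x c y"
proof (cases "\<forall>d\<in>active K. c d = 0")
  case True
  then show ?thesis using x balance_zero by blast
next
  case False
  then obtain d where d: "d \<in> active K" "c d \<noteq> 0" by blast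
  have "(\<Sum>d\<in>active K. c d) = c d + (\<Sum>e\<in>active K - {d}. c e)"
    using d by (intro sum.remove) auto
  then have "c d = 1" "(\<Sum>e\<in>active K - {d}. c e) = 0" using c d by linarith+
  then have c_eq: "c e = (if e = d then 1 else 0)" if "e \<in> active K" for e
    using that by (auto simp: sum_eq_0_iff)
  obtain w x' y z where xx: "x = (w, x', y, z)" by (cases x)
  have S: "w + x' + y + z \<le> K" using x xx by (simp add: Sigma_K_def)
  note r = enabled[OF d, unfolded xx]
  have bal: "balance K x c y = balance K x (\<lambda>e. if e = d then 1 else 0) y" for y
    using c_eq by (rule balance_cong)
  consider "d = Lam 1" | "d = Lam 2" | "d = Nu 1" | "d = Nu 2" | l where "d = Mu l" "1 \<le> l" "l \<le> K"
    using d by (auto simp: active_def)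
  then show ?thesis
  proof cases
    case 1
    then have "w + x' + y + z < K" using r by (auto simp: of_bool_def split: if_splits)
    then show ?thesis unfolding bal unfolding xx using 1
      by (intro bexI[of _ "(w + 1, x', y, z)"]) (auto simp: Sigma_K_def)
  next
    case 2
    then have "y > 0" using r by (auto simp: of_bool_def split: if_splits)
    then show ?thesis unfolding bal unfolding xx using 2 S
      by (intro bexI[of _ "(w, x', y - 1, z + 1)"]) (auto simp: Sigma_K_def)
  next
    case 3
    then have "w > 0" using r by auto
    then show ?thesis unfolding bal unfolding xx using 3 S
      by (intro bexI[of _ "(w - 1, x' + 1, y, z)"]) (auto simp: Sigma_K_def)
  next
    case 4
    then have "z > 0" using r by auto
    then show ?thesis unfolding bal unfolding xx using 4 S
      by (intro bexI[of _ "(w, x', y, z - 1)"]) (auto simp: Sigma_K_def)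
  next
    case 5
    then have "x' > 0" using r by (auto simp: of_bool_def split: if_splits)
    moreover have "(\<Sum>l'=1..K. if l' = l then 1 else 0) = (1::nat)" using 5 by simp
    ultimately show ?thesis unfolding bal unfolding xx using 5 S
      by (intro bexI[of _ "(w, x' - 1, y + 1, z)"]) (auto simp: Sigma_K_def)
  qed
qed

section \<open>Left limits of cadlag paths in the state space\<close>

lemma open_singleton_state: "open {x :: state}"
proof -
  obtain a b c d where x: "x = (a, b, c, d)" by (cases x)
  have "open ({a} \<times> {b} \<times> {c} \<times> {d})" by (intro open_Times) (rule Topological_Spaces.open_discrete)+
  then show ?thesis by (simp add: x)
qed

text \<open>The state space is discrete, so a left limit is the value at an actual earlier time, and
  later arguments pick such a time.\<close>

lemma tendsto_state_iff: "(f \<longlongrightarrow> (l :: state)) F \<longleftrightarrow> (\<forall>\<^sub>F u in F. f u = l)"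
  using topological_tendstoD[OF _ open_singleton_state, of f l F l] tendsto_eventually[of f l F]
  by auto

lemma left_lim_eqI:
  assumes "s \<noteq> 0" "(f \<longlongrightarrow> l) (at_left s)"
  shows "left_lim f s = l"
  using assms by (simp add: left_lim_def tendsto_Lim trivial_limit_at_left_real)

lemma left_lim_eventually:
  fixes f :: "real \<Rightarrow> state"
  assumes "f \<in> cadlag_paths T E" "s \<in> {0<..T}"
  shows "\<forall>\<^sub>F u in at_left s. f u = left_lim f s"
proof -
  obtain l where "(f \<longlongrightarrow> l) (at_left s)" using assms unfolding cadlag_paths_def by blast
  then show ?thesis using left_lim_eqI[of s f l] assms by (auto simp: tendsto_state_iff)
qed

lemma eventually_at_left_nonneg:
  assumes "(s::real) > 0"
  shows "\<forall>\<^sub>F u in at_left s. 0 \<le> u \<and> u < s"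
proof -
  have "\<forall>\<^sub>F u in at_left s. u \<in> {0<..<s}" by (rule eventually_at_leftI[OF _ assms]) simp
  then show ?thesis by eventually_elim auto
qed

lemma left_lim_witness:
  fixes f :: "real \<Rightarrow> state"
  assumes "f \<in> cadlag_paths T E" "s \<in> {0<..T}"
  shows "\<exists>u\<in>{0..<s}. left_lim f s = f u"
proof -
  have "\<forall>\<^sub>F u in at_left s. f u = left_lim f s \<and> 0 \<le> u \<and> u < s"
    using left_lim_eventually[OF assms] eventually_at_left_nonneg[of s] assms
    by (auto intro: eventually_conj)
  from eventually_happens'[OF trivial_limit_at_left_real this]
  obtain u where "f u = left_lim f s" "0 \<le> u" "u < s" by blast
  then show ?thesis by (intro bexI[of _ u]) auto
qed

lemma left_lim_in:
  fixes f :: "real \<Rightarrow> state"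
  assumes "f \<in> cadlag_paths T E" "s \<in> {0..T}"
  shows "left_lim f s \<in> E"
proof (cases "s = 0")
  case True
  then show ?thesis using assms by (auto simp: left_lim_def cadlag_paths_def)
next
  case False
  then obtain u where "u \<in> {0..<s}" "left_lim f s = f u"
    using left_lim_witness[OF assms(1), of s] assms(2) by auto
  then show ?thesis using assms by (auto simp: cadlag_paths_def)
qed

text \<open>The system is written with left limits of the coordinates and of their sum, the
  construction with left limits of the tuple; this mediates between them.\<close>

lemma left_lim_map:
  fixes f :: "real \<Rightarrow> state" and g :: "state \<Rightarrow> 'b :: t2_space"
  assumes "f \<in> cadlag_paths T E" "s \<in> {0..T}"
  shows "left_lim (\<lambda>u. g (f u)) s = g (left_lim f s)"
proof (cases "s = 0")
  case False
  have "\<forall>\<^sub>F u in at_left s. g (f u) = g (left_lim f s)"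
    using left_lim_eventually[OF assms(1), of s] False assms(2) by (auto elim: eventually_mono)
  then show ?thesis using False by (intro left_lim_eqI tendsto_eventually)
qed (simp add: left_lim_def)

lemma left_lim_cong:
  fixes f g :: "real \<Rightarrow> state"
  assumes f: "f \<in> cadlag_paths T E" and g: "g \<in> cadlag_paths T E" and s: "s \<in> {0<..T}"
    and eq: "\<And>u. u \<in> {0..<s} \<Longrightarrow> f u = g u"
  shows "left_lim f s = left_lim g s"
proof -
  have "\<forall>\<^sub>F u in at_left s. f u = left_lim f s \<and> g u = left_lim g s \<and> 0 \<le> u \<and> u < s"
    using left_lim_eventually[OF f s] left_lim_eventually[OF g s] eventually_at_left_nonneg[of s] s
    by (auto intro: eventually_conj)
  from eventually_happens'[OF trivial_limit_at_left_real this]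
  obtain u where "f u = left_lim f s" "g u = left_lim g s" "0 \<le> u" "u < s" by blast
  then show ?thesis using eq[of u] by simp
qed

section \<open>Flows through a configuration\<close>

context configuration
begin

text \<open>The integral equations for prescribed \<open>p\<close>, with integrals replaced by
  finite sums over the events. At \<open>t = 0\<close> the sum is empty, so the initial condition is
  included.\<close>

definition flow :: "(real \<Rightarrow> real \<times> real) \<Rightarrow> state \<Rightarrow> (real \<Rightarrow> state) \<Rightarrow> bool" where
  "flow p x0 f \<longleftrightarrow> (\<forall>t\<in>{0..T}. balance K x0
     (\<lambda>d. \<Sum>s\<in>events \<inter> {..t}. cnt d (region K p d (left_lim f s) {s})) (f t))"

text \<open>
  The solutions cannot separate before the first event on which \<open>p\<close> and \<open>q\<close> disagree. The induction
  is on the number of events up to \<open>t\<close>: left limits at events are determined by earlier times.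
\<close>

lemma flow_unique:
  assumes f: "f \<in> cadlag_paths T (Sigma_K K)" "flow p x0 f"
    and g: "g \<in> cadlag_paths T (Sigma_K K)" "flow q x0 g"
    and "t0 \<le> T"
    and agree: "\<And>s d x. s \<in> events \<Longrightarrow> s \<le> t0 \<Longrightarrow> d \<in> active K \<Longrightarrow> x \<in> Sigma_K K \<Longrightarrow>
      cnt d (region K p d x {s}) = cnt d (region K q d x {s})"
    and t: "t \<in> {0..t0}"
  shows "f t = g t"
  using t
proof (induction "card (events \<inter> {..t})" arbitrary: t rule: less_induct)
  case less
  have eq: "cnt d (region K p d (left_lim f s) {s}) = cnt d (region K q d (left_lim g s) {s})"
    if d: "d \<in> active K" and s: "s \<in> events \<inter> {..t}" for d s
  proof -
    have sT: "s \<in> {0<..T}" using s events_subset by auto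
    have "left_lim f s = left_lim g s"
    proof (rule left_lim_cong[OF f(1) g(1) sT])
      fix u assume u: "u \<in> {0..<s}"
      have "events \<inter> {..u} \<subseteq> events \<inter> {..t}" "s \<notin> events \<inter> {..u}" using u s by auto
      then have "events \<inter> {..u} \<subset> events \<inter> {..t}" using s by blast
      then have "card (events \<inter> {..u}) < card (events \<inter> {..t})" by (simp add: psubset_card_mono)
      moreover have "u \<in> {0..t0}" using u s less.prems by auto
      ultimately show "f u = g u" by (rule less.hyps)
    qed
    moreover have "left_lim g s \<in> Sigma_K K" using left_lim_in[OF g(1)] sT by simp
    ultimately show ?thesis using agree s d less.prems by auto
  qed
  have t: "t \<in> {0..T}" using less.prems \<open>t0 \<le> T\<close> by auto
  show ?case
  proof (rule balance_unique)
    show "balance K x0 (\<lambda>d. \<Sum>s\<in>events \<inter> {..t}. cnt d (region K p d (left_lim f s) {s})) (f t)"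
      using f t by (simp add: flow_def)
    show "balance K x0 (\<lambda>d. \<Sum>s\<in>events \<inter> {..t}. cnt d (region K q d (left_lim g s) {s})) (g t)"
      using g t by (simp add: flow_def)
  qed (use eq in \<open>auto intro!: sum.cong\<close>)
qed

section \<open>Construction of a flow by successive updates\<close>

definition run :: "(real \<Rightarrow> real \<times> real) \<Rightarrow> state \<Rightarrow> real set \<Rightarrow> state" where
  "run p x0 A = fold (\<lambda>s x. update K x (\<lambda>d. cnt d (region K p d x {s}))) (sorted_list_of_set A) x0"

text \<open>\<open>run\<close> takes a set of times so that the value at \<open>t\<close>, from the
  events up to \<open>t\<close>, and the left limit at \<open>s\<close>, from the events strictly
  before \<open>s\<close>, have the same form.\<close>

definition path :: "(real \<Rightarrow> real \<times> real) \<Rightarrow> state \<Rightarrow> real \<Rightarrow> state" where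
  "path p x0 t = run p x0 (events \<inter> {..t})"

lemma run_empty [simp]: "run p x0 {} = x0"
  by (simp add: run_def)

lemma run_insert:
  assumes "finite A" "\<And>a. a \<in> A \<Longrightarrow> a < s"
  shows "run p x0 (insert s A) = update K (run p x0 A) (\<lambda>d. cnt d (region K p d (run p x0 A) {s}))"
proof -
  have "s \<notin> A" using assms(2) by blast
  then have "sorted_list_of_set (insert s A) = sorted_list_of_set A @ [s]"
    using assms by (simp add: sorted_list_of_set_insert sorted_insort_is_snoc less_imp_le)
  then show ?thesis by (simp add: run_def)
qed

lemma run_in:
  assumes "x0 \<in> Sigma_K K" "finite A"
  shows "run p x0 A \<in> Sigma_K K"
  using assms(2)
  by (induction A rule: finite_linorder_max_induct) (use assms(1) in \<open>auto simp: run_insert update_in\<close>)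

lemma eventually_events_left: "\<forall>\<^sub>F u in at_left s. events \<inter> {..u} = events \<inter> {..<s}"
proof -
  have "\<forall>\<^sub>F u in at_left s. j \<le> u \<longleftrightarrow> j < s" for j
  proof (cases "j < s")
    case True
    have "\<forall>\<^sub>F u in at_left s. u \<in> {j<..<s}" by (rule eventually_at_leftI[OF _ True]) simp
    then show ?thesis by eventually_elim (use True in auto)
  next
    case False
    have "\<forall>\<^sub>F u in at_left s. u \<in> {s - 1<..<s}" by (rule eventually_at_leftI) auto
    then show ?thesis by eventually_elim (use False in auto)
  qed
  then have "\<forall>\<^sub>F u in at_left s. \<forall>j\<in>events. j \<le> u \<longleftrightarrow> j < s"
    by (intro eventually_ball_finite) auto
  then show ?thesis by eventually_elim auto
qed

lemma eventually_events_right: "\<forall>\<^sub>F u in at_right s. events \<inter> {..u} = events \<inter> {..s}"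
proof -
  have "\<forall>\<^sub>F u in at_right s. j \<le> u \<longleftrightarrow> j \<le> s" for j
  proof (cases "j \<le> s")
    case True
    have "\<forall>\<^sub>F u in at_right s. u \<in> {s<..<s + 1}" by (rule eventually_at_rightI) auto
    then show ?thesis by eventually_elim (use True in auto)
  next
    case False
    then have "s < j" by simp
    have "\<forall>\<^sub>F u in at_right s. u \<in> {s<..<j}" by (rule eventually_at_rightI[OF _ \<open>s < j\<close>]) simp
    then show ?thesis by eventually_elim (use False in auto)
  qed
  then have "\<forall>\<^sub>F u in at_right s. \<forall>j\<in>events. j \<le> u \<longleftrightarrow> j \<le> s"
    by (intro eventually_ball_finite) auto
  then show ?thesis by eventually_elim auto
qed

lemma path_tendsto_left: "(path p x0 \<longlongrightarrow> run p x0 (events \<inter> {..<s})) (at_left s)"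
  by (rule tendsto_eventually)
    (use eventually_events_left[of s] in eventually_elim, simp add: path_def)

lemma path_tendsto_right: "(path p x0 \<longlongrightarrow> path p x0 s) (at_right s)"
  by (rule tendsto_eventually)
    (use eventually_events_right[of s] in eventually_elim, simp add: path_def)

lemma path_cadlag: "x0 \<in> Sigma_K K \<Longrightarrow> path p x0 \<in> cadlag_paths T (Sigma_K K)"
  unfolding cadlag_paths_def using path_tendsto_left path_tendsto_right
  by (simp add: path_def run_in del: split_paired_Ex) blast

lemma path_left_lim: "s \<in> events \<Longrightarrow> left_lim (path p x0) s = run p x0 (events \<inter> {..<s})"
  using events_subset by (intro left_lim_eqI path_tendsto_left) auto

text \<open>The second condition is due to the closed threshold \<open>h \<le> rate\<close>: a point
  at height \<open>0\<close> would be accepted even at rate \<open>0\<close>, so that a jump could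
  start from an empty component.\<close>

definition simple :: bool where
  "simple \<longleftrightarrow> (\<forall>s\<in>events. (\<Sum>d\<in>active K. cnt d ({s} \<times> {0..real K})) \<le> 1) \<and>
     (\<forall>d\<in>active K. cnt d ({0..T} \<times> {0}) = 0)"

lemma balance_update:
  assumes simple: simple and p: "unit_valued p" "p \<in> borel_measurable borel"
    and x: "x \<in> Sigma_K K" and s: "s \<in> events"
  shows "balance K x (\<lambda>d. cnt d (region K p d x {s})) (update K x (\<lambda>d. cnt d (region K p d x {s})))"
proof -
  have sT: "0 \<le> s" "s \<le> T" using s events_subset by auto
  note reg = region_borel[OF p(2), of "{s}" K _ x] region_subset[OF p(1) K_pos x order_refl, of _ "{s}"]
  have box: "{s} \<times> {0..real K} \<subseteq> box" using sT by auto
  have "(\<Sum>d\<in>active K. cnt d (region K p d x {s})) \<le> (\<Sum>d\<in>active K. cnt d ({s} \<times> {0..real K}))"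
    using reg box by (intro sum_mono cnt_mono) auto
  also have "\<dots> \<le> 1" using simple s by (auto simp: simple_def)
  finally have "\<exists>y\<in>Sigma_K K. balance K x (\<lambda>d. cnt d (region K p d x {s})) y"
  proof (rule single_transition_in[OF x])
    fix d assume d: "d \<in> active K" "cnt d (region K p d x {s}) \<noteq> 0"
    show "rate K p d x s > 0"
    proof (rule ccontr)
      assume "\<not> rate K p d x s > 0"
      then have "region K p d x {s} \<subseteq> {0..T} \<times> {0}" using sT by (auto simp: region_def)
      then have "cnt d (region K p d x {s}) \<le> cnt d ({0..T} \<times> {0})"
        using d reg by (intro cnt_mono) auto
      then show False using d simple by (auto simp: simple_def)
    qed
  qed
  then show ?thesis using update_eq by metis
qed

text \<open>The balances of the single updates telescope. Adding a new largest time \<open>b\<close>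
  leaves the states before the earlier times unchanged.\<close>

lemma run_balance:
  assumes simple and p: "unit_valued p" "p \<in> borel_measurable borel" and x0: "x0 \<in> Sigma_K K"
    and A: "finite A" "A \<subseteq> events"
  shows "balance K x0 (\<lambda>d. \<Sum>s\<in>A. cnt d (region K p d (run p x0 (A \<inter> {..<s})) {s})) (run p x0 A)"
  using A
proof (induction A rule: finite_linorder_max_induct)
  case empty
  then show ?case by (simp add: balance_zero)
next
  case (insert b A)
  have b: "b \<notin> A" using insert.hyps by auto
  have 1: "insert b A \<inter> {..<s} = A \<inter> {..<s}" if "s \<in> A" for s
    using that insert.hyps by force
  have 2: "insert b A \<inter> {..<b} = A" using insert.hyps by force
  have "balance K (run p x0 A) (\<lambda>d. cnt d (region K p d (run p x0 A) {b})) (run p x0 (insert b A))"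
    using insert assms by (subst run_insert) (auto intro!: balance_update run_in)
  from balance_trans[OF insert.IH this] show ?case
    using insert b by (simp add: 1 2 add.commute)
qed

lemma path_flow:
  assumes simple "unit_valued p" "p \<in> borel_measurable borel" "x0 \<in> Sigma_K K"
  shows "flow p x0 (path p x0)"
  unfolding flow_def
proof
  fix t assume "t \<in> {0..T}"
  have 1: "run p x0 (events \<inter> {..t} \<inter> {..<s}) = left_lim (path p x0) s" if "s \<in> events \<inter> {..t}" for s
  proof -
    have "events \<inter> {..t} \<inter> {..<s} = events \<inter> {..<s}" using that by auto
    then show ?thesis using path_left_lim that by simp
  qed
  have "balance K x0 (\<lambda>d. \<Sum>s\<in>events \<inter> {..t}.
    cnt d (region K p d (run p x0 (events \<inter> {..t} \<inter> {..<s})) {s})) (path p x0 t)"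
    unfolding path_def using assms by (intro run_balance) auto
  moreover have "(\<lambda>d. \<Sum>s\<in>events \<inter> {..t}. cnt d (region K p d (run p x0 (events \<inter> {..t} \<inter> {..<s})) {s}))
    = (\<lambda>d. \<Sum>s\<in>events \<inter> {..t}. cnt d (region K p d (left_lim (path p x0) s) {s}))"
    by (intro ext sum.cong refl) (simp only: 1)
  ultimately show "balance K x0 (\<lambda>d. \<Sum>s\<in>events \<inter> {..t}. cnt d (region K p d (left_lim (path p x0) s) {s}))
    (path p x0 t)"
    by (simp only:)
qed

text \<open>An Euler scheme on \<open>n\<close> mesh intervals of \<open>{0..t}\<close>, with the
  state frozen on each. Given the current state it only counts points in deterministic sets, whereas
  \<open>run\<close> looks at random times; this is what makes adaptedness accessible.\<close>

primrec approx :: "(real \<Rightarrow> real \<times> real) \<Rightarrow> state \<Rightarrow> real \<Rightarrow> nat \<Rightarrow> nat \<Rightarrow> state" where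
  "approx p x0 t n 0 = x0"
| "approx p x0 t n (Suc k) = update K (approx p x0 t n k)
     (\<lambda>d. cnt d (region K p d (approx p x0 t n k) {t * real k / real n<..t * real (Suc k) / real n}))"

text \<open>If the mesh is finer than every gap between events, each mesh interval contains at most
  one event, and freezing the state over the interval causes no error.\<close>

lemma approx_eq_run:
  assumes p: "unit_valued p" "p \<in> borel_measurable borel" and x0: "x0 \<in> Sigma_K K"
    and t: "0 \<le> t" "t \<le> T" and n: "n > 0"
    and sep: "\<And>s s'. s \<in> events \<Longrightarrow> s' \<in> events \<Longrightarrow> s \<noteq> s' \<Longrightarrow> t / real n < \<bar>s - s'\<bar>"
  shows "k \<le> n \<Longrightarrow> approx p x0 t n k = run p x0 (events \<inter> {..t * real k / real n})"
proof (induction k)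
  case 0
  have "events \<inter> {..0} = {}" using events_subset by force
  then show ?case by simp
next
  case (Suc k)
  define a where "a = t * real k / real n"
  define b where "b = t * real (Suc k) / real n"
  have ab: "b = a + t / real n" by (simp add: a_def b_def field_simps add_divide_distrib)
  have a0: "0 \<le> a" using t by (simp add: a_def)
  have "t * real (Suc k) \<le> t * real n" using Suc.prems t by (intro mult_left_mono) auto
  then have bT: "b \<le> T" using n t by (simp add: b_def divide_le_eq) (smt (verit) mult_right_mono of_nat_0_le_iff)
  define x where "x = run p x0 (events \<inter> {..a})"
  have x: "approx p x0 t n k = x" using Suc by (simp add: x_def a_def)
  have xS: "x \<in> Sigma_K K" using x0 by (simp add: x_def run_in)
  have cnt: "cnt d (region K p d x {a<..b}) = (\<Sum>s\<in>events \<inter> {a<..b}. cnt d (region K p d x {s}))"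
    if d: "d \<in> active K" for d
  proof -
    have "cnt d (region K p d x {a<..b}) = (\<Sum>s\<in>events. cnt d (region K p d x {a<..b} \<inter> {s} \<times> UNIV))"
    proof (rule cnt_decomp[OF d region_borel[OF p(2)]])
      show "region K p d x {a<..b} \<subseteq> {0<..T} \<times> {0..real K}"
        using a0 bT by (intro region_subset[OF p(1) K_pos xS]) auto
    qed simp
    also have "\<dots> = (\<Sum>s\<in>events. if s \<in> {a<..b} then cnt d (region K p d x {s}) else 0)"
      by (intro sum.cong refl) (simp add: region_slice)
    also have "\<dots> = (\<Sum>s\<in>events \<inter> {a<..b}. cnt d (region K p d x {s}))"
      by (rule sum.inter_restrict[symmetric]) simp
    finally show ?thesis .
  qed
  have step: "approx p x0 t n (Suc k) = update K x (\<lambda>d. cnt d (region K p d x {a<..b}))"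
    using x by (simp add: a_def b_def)
  have le: "a \<le> b" using ab t by simp
  \<comment> \<open>Two distinct events in one mesh interval would be closer than its length
    \<open>t / real n\<close>.\<close>
  have same: "s = s'" if "s \<in> events \<inter> {a<..b}" "s' \<in> events \<inter> {a<..b}" for s s'
    using sep[of s s'] that ab by force
  show ?case
  proof (cases "events \<inter> {a<..b} = {}")
    case True
    then have "events \<inter> {..b} = events \<inter> {..a}" using le by force
    moreover have "update K x (\<lambda>d. cnt d (region K p d x {a<..b})) = x"
      using cnt True by (intro update_zero[OF xS]) simp
    ultimately show ?thesis using step by (simp add: x_def b_def)
  next
    case False
    then obtain s where s: "s \<in> events \<inter> {a<..b}" by blast
    then have one: "events \<inter> {a<..b} = {s}" using same by blast
    have "events \<inter> {..b} = (events \<inter> {..a}) \<union> (events \<inter> {a<..b})" using le by force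
    then have "events \<inter> {..b} = insert s (events \<inter> {..a})" using one by simp
    then have "run p x0 (events \<inter> {..b}) = update K x (\<lambda>d. cnt d (region K p d x {s}))"
      unfolding x_def using s by (simp, subst run_insert) auto
    moreover have "update K x (\<lambda>d. cnt d (region K p d x {a<..b})) =
      update K x (\<lambda>d. cnt d (region K p d x {s}))"
      using cnt one by (intro update_cong) simp
    ultimately show ?thesis using step by (simp add: b_def)
  qed
qed

text \<open>The required mesh depends on the configuration, so equality holds only eventually, but
  it does so for every configuration. The path is thus adapted without adding null sets to the
  filtration.\<close>

lemma eventually_approx_eq_path:
  assumes "unit_valued p" "p \<in> borel_measurable borel" "x0 \<in> Sigma_K K" "0 \<le> t" "t \<le> T"
  shows "\<forall>\<^sub>F n in sequentially. approx p x0 t n n = path p x0 t"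
proof -
  have lim: "(\<lambda>n. t / real n) \<longlonglongrightarrow> 0" by (rule lim_const_over_n)
  have "\<forall>\<^sub>F n in sequentially. s \<noteq> s' \<longrightarrow> t / real n < \<bar>s - s'\<bar>" for s s'
    using order_tendstoD(2)[OF lim, of "\<bar>s - s'\<bar>"] by (cases "s = s'") auto
  then have "\<forall>\<^sub>F n in sequentially. \<forall>s\<in>events. \<forall>s'\<in>events. s \<noteq> s' \<longrightarrow> t / real n < \<bar>s - s'\<bar>"
    by (intro eventually_ball_finite ballI) auto
  with eventually_gt_at_top[of 0] show ?thesis
  proof eventually_elim
    case (elim n)
    have "approx p x0 t n n = run p x0 (events \<inter> {..t * real n / real n})"
      by (rule approx_eq_run[OF assms]) (use elim in auto)
    with elim show ?case by (simp add: path_def)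
  qed
qed

end

section \<open>The driving processes\<close>

text \<open>The functions \<open>'d \<Rightarrow> nat\<close> may form an uncountable space, so the
  coordinates are fixed one at a time: each takes countably many values, and \<open>h\<close> is
  finally a constant.\<close>

lemma measurable_finitely_many_coordinates:
  fixes c :: "'w \<Rightarrow> 'd \<Rightarrow> nat" and h :: "('d \<Rightarrow> nat) \<Rightarrow> 'b"
  assumes "finite D" "\<And>d. d \<in> D \<Longrightarrow> (\<lambda>\<omega>. c \<omega> d) \<in> N \<rightarrow>\<^sub>M count_space UNIV"
    and "\<And>a b. (\<And>d. d \<in> D \<Longrightarrow> a d = b d) \<Longrightarrow> h a = h b"
  shows "(\<lambda>\<omega>. h (c \<omega>)) \<in> N \<rightarrow>\<^sub>M count_space UNIV"
  using assms
proof (induction D arbitrary: h)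
  case empty
  then have "h (c \<omega>) = h (\<lambda>_. 0)" for \<omega> by blast
  then show ?case by simp
next
  case (insert d D)
  have "(\<lambda>\<omega>. h ((c \<omega>)(d := n))) \<in> N \<rightarrow>\<^sub>M count_space UNIV" for n
  proof (rule insert.IH[where h = "\<lambda>a. h (a(d := n))"])
    show "h (a(d := n)) = h (b(d := n))" if "\<And>e. e \<in> D \<Longrightarrow> a e = b e" for a b
      using that by (intro insert.prems(2)) auto
  qed (use insert.prems(1) in auto)
  from measurable_compose_countable[where f = "\<lambda>n \<omega>. h ((c \<omega>)(d := n))", OF this insert.prems(1)[of d]]
  show ?case by simp
qed

lemma measurable_eventually_eq:
  fixes f :: "nat \<Rightarrow> 'w \<Rightarrow> 'b :: countable"
  assumes [measurable]: "\<And>n. f n \<in> N \<rightarrow>\<^sub>M count_space UNIV"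
    and "\<And>\<omega>. \<omega> \<in> space N \<Longrightarrow> \<forall>\<^sub>F n in sequentially. f n \<omega> = g \<omega>"
  shows "g \<in> N \<rightarrow>\<^sub>M count_space UNIV"
proof (subst measurable_count_space_eq2_countable, intro conjI ballI)
  fix a
  have "g \<omega> = a \<longleftrightarrow> (\<exists>m. \<forall>n\<ge>m. f n \<omega> = a)" if \<omega>: "\<omega> \<in> space N" for \<omega>
  proof -
    obtain m where m: "\<And>n. n \<ge> m \<Longrightarrow> f n \<omega> = g \<omega>"
      using assms(2)[OF \<omega>] by (auto simp: eventually_sequentially)
    show ?thesis
    proof
      assume "\<exists>m. \<forall>n\<ge>m. f n \<omega> = a"
      then obtain m' where "\<forall>n\<ge>m'. f n \<omega> = a" by blast
      then show "g \<omega> = a" using m[of "max m m'"] by simp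
    qed (use m in blast)
  qed
  then have "g -` {a} \<inter> space N = {\<omega> \<in> space N. \<exists>m. \<forall>n\<ge>m. f n \<omega> = a}" by auto
  also have "\<dots> \<in> sets N" by measurable
  finally show "g -` {a} \<inter> space N \<in> sets N" .
qed simp

section \<open>Planar versions of the driving processes and their measurability\<close>

locale mean_field_system = prob_space M for M :: "'w measure" +
  fixes Nlam Nnu :: "nat \<Rightarrow> 'w \<Rightarrow> (real \<times> real) measure"
    and Nmu :: "nat \<Rightarrow> 'w \<Rightarrow> real measure"
    and lam mu nu T :: real and K :: nat
  assumes lam_pos: "lam > 0" and mu_pos: "mu > 0" and nu_pos: "nu > 0"
    and K_pos: "K \<ge> 1" and T_pos: "T > 0"
    and drivers: "driving_processes M Nlam Nnu Nmu lam nu mu"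
begin

text \<open>The image under the identity only enlarges the space: the given processes live on the
  quarter plane or the half line, their images on all Borel sets of the plane, with no mass outside
  the quadrant.\<close>

fun Q :: "driver \<Rightarrow> 'w \<Rightarrow> (real \<times> real) measure" where
  "Q (Lam i) \<omega> = distr (Nlam i \<omega>) borel (\<lambda>v. v)"
| "Q (Nu i) \<omega> = distr (Nnu i \<omega>) borel (\<lambda>v. v)"
| "Q (Mu l) \<omega> = distr (Nmu l \<omega>) borel (\<lambda>s. (s, 1))"

fun intensity :: "driver \<Rightarrow> (real \<times> real) set \<Rightarrow> real" where
  "intensity (Lam i) B = lam * measure lborel B"
| "intensity (Nu i) B = nu * measure lborel B"
| "intensity (Mu l) B = mu * measure lborel {s. (s, 1) \<in> B}"

abbreviation quadrant :: "(real \<times> real) set" where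
  "quadrant \<equiv> {0..} \<times> {0..}"

lemma sets_Q [simp]: "sets (Q d \<omega>) = sets borel"
  by (cases d) auto

lemma quadrant_borel: "quadrant \<in> sets borel"
  by (intro borel_closed closed_Times) auto

lemma sets_quarter_plane: "B \<in> sets (quarter_plane c) \<longleftrightarrow> B \<subseteq> quadrant \<and> B \<in> sets borel"
  using quadrant_borel by (simp add: quarter_plane_def sets_restrict_space_iff)

lemma sets_half_line: "B \<in> sets (half_line c) \<longleftrightarrow> B \<subseteq> {0..} \<and> B \<in> sets borel"
  by (simp add: half_line_def sets_restrict_space_iff)

lemma pp_Lam: "i \<in> {1, 2} \<Longrightarrow> poisson_point_process M (quarter_plane lam) (Nlam i)"
  and pp_Nu: "i \<in> {1, 2} \<Longrightarrow> poisson_point_process M (quarter_plane nu) (Nnu i)"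
  and pp_Mu: "l \<ge> 1 \<Longrightarrow> poisson_point_process M (half_line mu) (Nmu l)"
  using drivers by (auto simp: driving_processes_def)

lemma pp_sets:
  "poisson_point_process M \<Lambda> N \<Longrightarrow> \<omega> \<in> space M \<Longrightarrow> sets (N \<omega>) = sets \<Lambda>"
  by (auto simp: poisson_point_process_def point_process_def)

lemma space_planar:
  "poisson_point_process M (quarter_plane c) N \<Longrightarrow> \<omega> \<in> space M \<Longrightarrow> space (N \<omega>) = quadrant"
  using sets_eq_imp_space_eq[OF pp_sets]
  by (fastforce simp: quarter_plane_def space_scale_measure space_restrict_space)

lemma space_linear:
  "poisson_point_process M (half_line c) N \<Longrightarrow> \<omega> \<in> space M \<Longrightarrow> space (N \<omega>) = {0..}"
  using sets_eq_imp_space_eq[OF pp_sets]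
  by (fastforce simp: half_line_def space_scale_measure space_restrict_space)

lemma planar_distr:
  assumes "poisson_point_process M (quarter_plane c) N" "\<omega> \<in> space M" "B \<in> sets borel"
  shows "emeasure (distr (N \<omega>) borel (\<lambda>v. v)) B = emeasure (N \<omega>) (B \<inter> quadrant)"
proof -
  note s = pp_sets[OF assms(1,2)] and sp = space_planar[OF assms(1,2)]
  have "(\<lambda>v. v) \<in> N \<omega> \<rightarrow>\<^sub>M borel"
  proof (rule measurableI)
    fix A :: "(real \<times> real) set" assume "A \<in> sets borel"
    then have "A \<inter> quadrant \<in> sets (quarter_plane c)"
      unfolding sets_quarter_plane using quadrant_borel by auto
    then show "(\<lambda>v. v) -` A \<inter> space (N \<omega>) \<in> sets (N \<omega>)" using s sp by simp
  qed simp
  then show ?thesis using assms(3) by (simp add: emeasure_distr sp)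
qed

lemma trace_borel: "B \<in> sets borel \<Longrightarrow> {s::real. (s, 1::real) \<in> B} \<in> sets borel"
proof -
  assume "B \<in> sets borel"
  then have "(\<lambda>s::real. (s, 1::real)) -` B \<inter> space borel \<in> sets borel"
    by (rule measurable_sets[rotated]) (simp add: borel_prod[symmetric])
  then show ?thesis by (simp add: vimage_def)
qed

lemma linear_distr:
  assumes "poisson_point_process M (half_line c) N" "\<omega> \<in> space M" "B \<in> sets borel"
  shows "emeasure (distr (N \<omega>) borel (\<lambda>s. (s, 1::real))) B = emeasure (N \<omega>) ({s. (s, 1) \<in> B} \<inter> {0..})"
proof -
  note s = pp_sets[OF assms(1,2)] and sp = space_linear[OF assms(1,2)]
  have "(\<lambda>s. (s, 1::real)) \<in> N \<omega> \<rightarrow>\<^sub>M borel"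
  proof (rule measurableI)
    fix A :: "(real \<times> real) set" assume "A \<in> sets borel"
    then have "{s. (s, 1) \<in> A} \<inter> {0..} \<in> sets (half_line c)"
      unfolding sets_half_line using trace_borel by auto
    then show "(\<lambda>s. (s, 1)) -` A \<inter> space (N \<omega>) \<in> sets (N \<omega>)" using s sp by (simp add: vimage_def)
  qed simp
  then show ?thesis using assms(3) by (simp add: emeasure_distr sp vimage_def)
qed

lemma Q_planar:
  assumes "\<omega> \<in> space M" "B \<in> sets borel" "i \<in> {1, 2}"
  shows "emeasure (Q (Lam i) \<omega>) B = emeasure (Nlam i \<omega>) (B \<inter> quadrant)"
    and "emeasure (Q (Nu i) \<omega>) B = emeasure (Nnu i \<omega>) (B \<inter> quadrant)"
  using planar_distr[OF pp_Lam[OF assms(3)] assms(1,2)] planar_distr[OF pp_Nu[OF assms(3)] assms(1,2)]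
  by simp_all

lemma Q_linear:
  assumes "\<omega> \<in> space M" "B \<in> sets borel" "l \<ge> 1"
  shows "emeasure (Q (Mu l) \<omega>) B = emeasure (Nmu l \<omega>) ({s. (s, 1) \<in> B} \<inter> {0..})"
  using linear_distr[OF pp_Mu[OF assms(3)] assms(1,2)] by simp

lemma active_cases [consumes 1, case_names Lam Nu Mu]:
  assumes "d \<in> active K"
  obtains i where "d = Lam i" "i \<in> {1, 2}" | i where "d = Nu i" "i \<in> {1, 2}"
    | l where "d = Mu l" "1 \<le> l"
  using assms by (auto simp: active_def)

lemma bounded_trace: "bounded B \<Longrightarrow> bounded ({s::real. (s, 1::real) \<in> B} \<inter> {0..})"
proof -
  assume "bounded B"
  then have "bounded (fst ` B)" by (rule bounded_fst)
  then show ?thesis by (rule bounded_subset) force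
qed

lemma Q_nat:
  assumes "\<omega> \<in> space M" "d \<in> active K" "B \<in> sets borel" "bounded B"
  shows "\<exists>n::nat. emeasure (Q d \<omega>) B = of_nat n"
proof -
  have pp: "\<exists>n::nat. emeasure (N \<omega>) A = of_nat n"
    if "poisson_point_process M \<Lambda> N" "A \<in> sets \<Lambda>" "bounded A" for \<Lambda> A and N :: "'w \<Rightarrow> ('e::metric_space) measure"
    using that assms(1) by (auto simp: poisson_point_process_def point_process_def)
  have pl: "B \<inter> quadrant \<in> sets (quarter_plane c)" "bounded (B \<inter> quadrant)" for c
    using assms(3,4) quadrant_borel by (auto simp: sets_quarter_plane intro: bounded_subset)
  have li: "{s. (s, 1) \<in> B} \<inter> {0..} \<in> sets (half_line c)" for c
    using assms(3) trace_borel by (auto simp: sets_half_line)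
  from assms(2) show ?thesis
  proof (cases rule: active_cases)
    case (Lam i)
    show ?thesis unfolding Lam(1) Q_planar(1)[OF assms(1,3) Lam(2)] by (rule pp[OF pp_Lam[OF Lam(2)] pl])
  next
    case (Nu i)
    show ?thesis unfolding Nu(1) Q_planar(2)[OF assms(1,3) Nu(2)] by (rule pp[OF pp_Nu[OF Nu(2)] pl])
  next
    case (Mu l)
    show ?thesis unfolding Mu(1) Q_linear[OF assms(1,3) Mu(2)]
      by (rule pp[OF pp_Mu[OF Mu(2)] li bounded_trace[OF assms(4)]])
  qed
qed

lemma configuration: "\<omega> \<in> space M \<Longrightarrow> configuration (\<lambda>d. Q d \<omega>) K T"
proof
  assume \<omega>: "\<omega> \<in> space M"
  fix d B assume "d \<in> active K" "B \<in> sets borel" "B \<subseteq> {0..T} \<times> {0..real K}"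
  moreover have "bounded ({0..T} \<times> {0..real K})" by (intro bounded_Times bounded_closed_interval)
  ultimately show "\<exists>n::nat. emeasure (Q d \<omega>) B = of_nat n"
    using Q_nat[OF \<omega>] bounded_subset by blast
qed (use K_pos in auto)

text \<open>Used with \<open>I = {0..}\<close> for independence of the drivers and with
  \<open>I = {0..t}\<close> for adaptedness.\<close>

definition driver_algebra :: "real set \<Rightarrow> driver \<Rightarrow> 'w measure" where
  "driver_algebra I d = sigma (space M) (driver_events M Nlam Nnu Nmu I d)"

lemma driver_events_Pow: "driver_events M Nlam Nnu Nmu I d \<subseteq> Pow (space M)"
  by (cases d) (auto simp: pp_events_def)

lemma sets_driver_algebra:
  "sets (driver_algebra I d) = sigma_sets (space M) (driver_events M Nlam Nnu Nmu I d)"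
  "space (driver_algebra I d) = space M"
  using driver_events_Pow by (simp_all add: driver_algebra_def sets_measure_of)

lemma active_drivers: "d \<in> active K \<Longrightarrow> d \<in> drivers"
  by (auto simp: active_def drivers_def)

lemma Q_measurable_driver:
  assumes d: "d \<in> active K" and B: "B \<in> sets borel" "B \<inter> quadrant \<subseteq> I \<times> UNIV"
  shows "(\<lambda>\<omega>. emeasure (Q d \<omega>) B) \<in> borel_measurable (driver_algebra I d)"
proof (rule measurableI)
  fix A :: "ennreal set" assume A: "A \<in> sets borel"
  have pl: "B \<inter> quadrant \<in> {B \<in> sets borel. B \<subseteq> I \<times> {0..}}"
    using B quadrant_borel by auto
  have li: "{s. (s, 1) \<in> B} \<inter> {0..} \<in> {B \<in> sets borel. B \<subseteq> I}"
    using B trace_borel by auto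
  from d have "(\<lambda>\<omega>. emeasure (Q d \<omega>) B) -` A \<inter> space M \<in> driver_events M Nlam Nnu Nmu I d"
  proof (cases rule: active_cases)
    case (Lam i)
    have "(\<lambda>\<omega>. emeasure (Q d \<omega>) B) -` A \<inter> space M
      = (\<lambda>\<omega>. emeasure (Nlam i \<omega>) (B \<inter> quadrant)) -` A \<inter> space M"
      using Q_planar(1)[OF _ B(1) Lam(2)] Lam(1) by auto
    then show ?thesis using pl A Lam(1) by (auto simp: pp_events_def)
  next
    case (Nu i)
    have "(\<lambda>\<omega>. emeasure (Q d \<omega>) B) -` A \<inter> space M
      = (\<lambda>\<omega>. emeasure (Nnu i \<omega>) (B \<inter> quadrant)) -` A \<inter> space M"
      using Q_planar(2)[OF _ B(1) Nu(2)] Nu(1) by auto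
    then show ?thesis using pl A Nu(1) by (auto simp: pp_events_def)
  next
    case (Mu l)
    have "(\<lambda>\<omega>. emeasure (Q d \<omega>) B) -` A \<inter> space M
      = (\<lambda>\<omega>. emeasure (Nmu l \<omega>) ({s. (s, 1) \<in> B} \<inter> {0..})) -` A \<inter> space M"
      using Q_linear[OF _ B(1) Mu(2)] Mu(1) by auto
    then show ?thesis using li A Mu(1) by (auto simp: pp_events_def)
  qed
  then show "(\<lambda>\<omega>. emeasure (Q d \<omega>) B) -` A \<inter> space (driver_algebra I d) \<in> sets (driver_algebra I d)"
    by (simp add: sets_driver_algebra)
qed simp

lemma driver_indep: "indep_sets (\<lambda>d. sets (driver_algebra {0..} d)) drivers"
  using drivers by (simp add: driving_processes_def sets_driver_algebra)

lemma driver_algebra_events: "d \<in> drivers \<Longrightarrow> sets (driver_algebra {0..} d) \<subseteq> events"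
  using driver_indep by (simp add: indep_sets_def)

lemma Q_measurable:
  assumes "d \<in> active K" "B \<in> sets borel"
  shows "(\<lambda>\<omega>. emeasure (Q d \<omega>) B) \<in> borel_measurable M"
proof -
  have "(\<lambda>\<omega>. emeasure (Q d \<omega>) B) \<in> borel_measurable (driver_algebra {0..} d)"
    using assms by (intro Q_measurable_driver) auto
  then show ?thesis
    using driver_algebra_events[OF active_drivers[OF assms(1)]]
    by (intro measurable_from_subalg[of M]) (auto simp: subalgebra_def sets_driver_algebra)
qed

abbreviation filtration :: "real \<Rightarrow> 'w measure" where
  "filtration t \<equiv> driving_filtration M Nlam Nnu Nmu t"

lemma space_filtration [simp]: "space (filtration t) = space M"
  using driver_events_Pow by (auto simp: driving_filtration_def intro!: space_measure_of)

lemma sets_filtration: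
  "sets (filtration t) = sigma_sets (space M) (\<Union>d\<in>drivers. driver_events M Nlam Nnu Nmu {0..t} d)"
  using driver_events_Pow by (auto simp: driving_filtration_def intro!: sets_measure_of)

lemma Q_adapted:
  assumes "d \<in> active K" "B \<in> sets borel" "B \<subseteq> {0..t} \<times> UNIV"
  shows "(\<lambda>\<omega>. emeasure (Q d \<omega>) B) \<in> borel_measurable (filtration t)"
proof -
  have "(\<lambda>\<omega>. emeasure (Q d \<omega>) B) \<in> borel_measurable (driver_algebra {0..t} d)"
    using assms by (intro Q_measurable_driver) auto
  moreover have "sets (driver_algebra {0..t} d) \<subseteq> sets (filtration t)"
    unfolding sets_driver_algebra sets_filtration
    using active_drivers[OF assms(1)] by (intro sigma_sets_mono') auto
  ultimately show ?thesis
    by (intro measurable_from_subalg[of "filtration t"]) (auto simp: subalgebra_def sets_driver_algebra)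
qed

lemma driver_events_mono:
  "I \<subseteq> J \<Longrightarrow> driver_events M Nlam Nnu Nmu I d \<subseteq> driver_events M Nlam Nnu Nmu J d"
  by (cases d) (fastforce simp: pp_events_def)+

lemma filtration_le: "sets (filtration t) \<subseteq> events"
  unfolding sets_filtration
proof (rule sets.sigma_sets_subset, safe)
  fix d A assume d: "d \<in> drivers" and A: "A \<in> driver_events M Nlam Nnu Nmu {0..t} d"
  then have "A \<in> driver_events M Nlam Nnu Nmu {0..} d"
    using driver_events_mono[of "{0..t}" "{0..}" d] by auto
  then show "A \<in> events"
    using driver_algebra_events[OF d] by (auto simp: sets_driver_algebra)
qed

lemma adapted_measurable: "f \<in> filtration t \<rightarrow>\<^sub>M N \<Longrightarrow> f \<in> M \<rightarrow>\<^sub>M N"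
  by (rule measurable_from_subalg) (auto simp: subalgebra_def filtration_le[THEN subsetD])

abbreviation points :: "'w \<Rightarrow> driver \<Rightarrow> (real \<times> real) set \<Rightarrow> nat" where
  "points \<omega> \<equiv> configuration.cnt (\<lambda>d. Q d \<omega>)"

lemma cnt_eq:
  assumes "\<omega> \<in> space M" "d \<in> active K" "B \<in> sets borel" "B \<subseteq> {0..T} \<times> {0..real K}"
  shows "points \<omega> d B = n \<longleftrightarrow> emeasure (Q d \<omega>) B = of_nat n"
  using configuration.emeasure_cnt[OF configuration[OF assms(1)] assms(2-)]
  by (simp add: ennreal_of_nat_eq_real_of_nat)

lemma cnt_eq_emeasure:
  assumes "\<omega> \<in> space M"
  shows "points \<omega> d B = nat \<lfloor>enn2real (emeasure (Q d \<omega>) B)\<rfloor>"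
  using configuration.cnt_def[OF configuration[OF assms]] by (simp add: measure_def)

lemma cnt_measurableI:
  assumes "(\<lambda>\<omega>. emeasure (Q d \<omega>) B) \<in> borel_measurable N" "space N = space M"
  shows "(\<lambda>\<omega>. points \<omega> d B) \<in> N \<rightarrow>\<^sub>M count_space UNIV"
proof -
  have "(\<lambda>\<omega>. \<lfloor>enn2real (emeasure (Q d \<omega>) B)\<rfloor>) \<in> N \<rightarrow>\<^sub>M count_space UNIV"
    by (rule measurable_compose[OF borel_measurable_enn2real[OF assms(1)] measurable_real_floor])
  then have "(\<lambda>\<omega>. nat \<lfloor>enn2real (emeasure (Q d \<omega>) B)\<rfloor>) \<in> N \<rightarrow>\<^sub>M count_space UNIV"
    by (rule measurable_compose) simp
  then show ?thesis
    by (rule measurable_cong[THEN iffD1, rotated]) (simp add: cnt_eq_emeasure assms(2))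
qed

section \<open>The process driven by given acceptance probabilities\<close>

text \<open>Defined for every outcome, so that all paths are cadlag in the state space; the
  equations are claimed only where the configuration is \<open>simple\<close>.\<close>

definition process :: "(real \<Rightarrow> real \<times> real) \<Rightarrow> state \<Rightarrow> real \<Rightarrow> 'w \<Rightarrow> state" where
  "process p x0 t \<omega> = configuration.path (\<lambda>d. Q d \<omega>) K T p x0 t"

text \<open>The preceding state takes countably many values. For each of them the region is a
  deterministic set within time \<open>t\<close>, so the count is adapted, and
  \<open>measurable_compose_countable\<close> puts the cases together.\<close>

lemma approx_adapted:
  assumes p: "p \<in> borel_measurable borel" and t: "0 \<le> t" and n: "n > 0"
  shows "k \<le> n \<Longrightarrow>
    (\<lambda>\<omega>. configuration.approx (\<lambda>d. Q d \<omega>) K p x0 t n k) \<in> filtration t \<rightarrow>\<^sub>M count_space UNIV"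
proof (induction k)
  case 0
  have "x0 = configuration.approx (\<lambda>d. Q d \<omega>) K p x0 t n 0" if "\<omega> \<in> space (filtration t)" for \<omega>
    using configuration.approx.simps(1)[OF configuration] that by simp
  then show ?case by (rule measurable_cong[THEN iffD1]) auto
next
  case (Suc k)
  let ?I = "{t * real k / real n<..t * real (Suc k) / real n}"
  let ?a = "\<lambda>\<omega>. configuration.approx (\<lambda>d. Q d \<omega>) K p x0 t n"
  have "t * real (Suc k) \<le> t * real n" using Suc.prems t by (intro mult_left_mono) auto
  then have le: "t * real (Suc k) / real n \<le> t" using n by (simp add: divide_le_eq)
  have "0 \<le> t * real k / real n" using t by simp
  then have I: "?I \<subseteq> {0..t}" using le by force
  have "(\<lambda>\<omega>. update K x (\<lambda>d. points \<omega> d (region K p d x ?I))) \<in> filtration t \<rightarrow>\<^sub>M count_space UNIV" for x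
  proof (rule measurable_finitely_many_coordinates[OF finite_active])
    fix d assume d: "d \<in> active K"
    have "region K p d x ?I \<subseteq> {0..t} \<times> UNIV" using I by (auto simp: region_def)
    then show "(\<lambda>\<omega>. points \<omega> d (region K p d x ?I)) \<in> filtration t \<rightarrow>\<^sub>M count_space UNIV"
      using d by (intro cnt_measurableI Q_adapted region_borel[OF p]) auto
  qed (rule update_cong)
  then have "(\<lambda>\<omega>. update K (?a \<omega> k) (\<lambda>d. points \<omega> d (region K p d (?a \<omega> k) ?I)))
    \<in> filtration t \<rightarrow>\<^sub>M count_space UNIV"
    by (rule measurable_compose_countable[where g = "\<lambda>\<omega>. ?a \<omega> k"]) (use Suc in auto)
  then show ?case
    by (rule measurable_cong[THEN iffD1, rotated])
      (simp add: configuration.approx.simps(2)[OF configuration])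
qed

lemma process_adapted:
  assumes "unit_valued p" "p \<in> borel_measurable borel" "x0 \<in> Sigma_K K" "t \<in> {0..T}"
  shows "process p x0 t \<in> filtration t \<rightarrow>\<^sub>M count_space UNIV"
proof (rule measurable_eventually_eq)
  show "(\<lambda>\<omega>. configuration.approx (\<lambda>d. Q d \<omega>) K p x0 t (Suc n) (Suc n)) \<in> filtration t \<rightarrow>\<^sub>M count_space UNIV" for n
    using assms by (intro approx_adapted) auto
  fix \<omega> assume "\<omega> \<in> space (filtration t)"
  then have "\<forall>\<^sub>F n in sequentially. configuration.approx (\<lambda>d. Q d \<omega>) K p x0 t n n = process p x0 t \<omega>"
    unfolding process_def using assms
    by (intro configuration.eventually_approx_eq_path[OF configuration]) auto
  then show "\<forall>\<^sub>F n in sequentially.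
      configuration.approx (\<lambda>d. Q d \<omega>) K p x0 t (Suc n) (Suc n) = process p x0 t \<omega>"
    by (rule eventually_sequentially_Suc[THEN iffD2])
qed

lemma process_cadlag:
  "x0 \<in> Sigma_K K \<Longrightarrow> \<omega> \<in> space M \<Longrightarrow> (\<lambda>t. process p x0 t \<omega>) \<in> cadlag_paths T (Sigma_K K)"
  unfolding process_def by (rule configuration.path_cadlag[OF configuration])

end

section \<open>Poisson estimates\<close>

text \<open>Contains every height that exactly one of the two thresholds accepts. Taking both
  boundary curves along costs no area and keeps the set independent of which threshold is
  larger.\<close>

definition band :: "(real \<Rightarrow> real) \<Rightarrow> (real \<Rightarrow> real) \<Rightarrow> real \<Rightarrow> (real \<times> real) set" where
  "band f g t = {(s, h). s \<in> {0..t} \<and> min (f s) (g s) \<le> h \<and> h \<le> max (f s) (g s)}"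

lemma band_borel:
  assumes [measurable]: "f \<in> borel_measurable borel" "g \<in> borel_measurable borel"
  shows "band f g t \<in> sets borel"
proof -
  have "{v \<in> space (borel \<Otimes>\<^sub>M borel). fst v \<in> {0..t} \<and> min (f (fst v)) (g (fst v)) \<le> snd v
      \<and> snd v \<le> max (f (fst v)) (g (fst v))}
    \<in> sets (borel \<Otimes>\<^sub>M (borel :: real measure))"
    by measurable
  also have "{v \<in> space (borel \<Otimes>\<^sub>M borel). fst v \<in> {0..t} \<and> min (f (fst v)) (g (fst v)) \<le> snd v
      \<and> snd v \<le> max (f (fst v)) (g (fst v))} = band f g t"
    by (auto simp: space_pair_measure band_def)
  finally show ?thesis unfolding borel_prod .
qed

text \<open>By Fubini the area is the integral of \<open>\<bar>f s - g s\<bar>\<close>. Integrating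
  the exponential gains the factor \<open>1 / b\<close>, which is the source of the
  contraction.\<close>

lemma area_band:
  assumes fg: "f \<in> borel_measurable borel" "g \<in> borel_measurable borel"
    and close: "\<And>s. s \<in> {0..t} \<Longrightarrow> \<bar>f s - g s\<bar> \<le> C * exp (b * s)"
    and "b > 0" "0 \<le> C" "0 \<le> t"
  shows "measure lborel (band f g t) \<le> C * exp (b * t) / b"
proof -
  have "band f g t \<in> sets (lborel \<Otimes>\<^sub>M lborel)"
    unfolding lborel_prod using band_borel[OF fg] by simp
  then have "emeasure lborel (band f g t) = (\<integral>\<^sup>+ s. emeasure lborel (Pair s -` band f g t) \<partial>lborel)"
    unfolding lborel_prod[symmetric] by (rule lborel.emeasure_pair_measure_alt)
  also have "\<dots> \<le> (\<integral>\<^sup>+ s. ennreal (C * exp (b * s)) * indicator {0..t} s \<partial>lborel)"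
  proof (rule nn_integral_mono)
    fix s :: real
    have "Pair s -` band f g t = (if s \<in> {0..t} then {min (f s) (g s)..max (f s) (g s)} else {})"
      by (auto simp: band_def)
    moreover have "max (f s) (g s) - min (f s) (g s) = \<bar>f s - g s\<bar>" by (simp add: max_def min_def)
    ultimately show "emeasure lborel (Pair s -` band f g t) \<le> ennreal (C * exp (b * s)) * indicator {0..t} s"
      using close[of s] by (auto intro!: ennreal_leI)
  qed
  also have "\<dots> = ennreal (C * exp (b * t) / b - C * exp (b * 0) / b)"
    using assms by (intro nn_integral_FTC_Icc) (auto intro!: derivative_eq_intros)
  also have "\<dots> \<le> ennreal (C * exp (b * t) / b)"
    using assms by (intro ennreal_leI) simp
  finally show ?thesis
    unfolding measure_def using assms by (intro enn2real_leI) auto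
qed

lemma measure_rectangle:
  assumes "a \<le> b" "c \<le> d"
  shows "measure lborel ({a<..b} \<times> {c..d::real}) = (b - a) * (d - c)"
    and "measure lborel ({a..b} \<times> {c..d::real}) = (b - a) * (d - c)"
proof -
  have "emeasure lborel ({a<..b} \<times> {c..d}) = emeasure lborel {a<..b} * emeasure lborel {c..d}"
    "emeasure lborel ({a..b} \<times> {c..d}) = emeasure lborel {a..b} * emeasure lborel {c..d}"
    unfolding lborel_prod[symmetric] by (rule lborel.emeasure_pair_measure_Times; simp)+
  then show "measure lborel ({a<..b} \<times> {c..d::real}) = (b - a) * (d - c)"
    "measure lborel ({a..b} \<times> {c..d::real}) = (b - a) * (d - c)"
    using assms by (simp_all add: measure_def enn2real_mult)
qed

text \<open>Separates the two ways of having a multiple point: two points of one driver, controlled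
  by the Poisson weights, or one point of each of two drivers, controlled by independence.\<close>

lemma two_le_sum_cases:
  fixes c :: "'d \<Rightarrow> nat"
  assumes "finite D" "2 \<le> (\<Sum>d\<in>D. c d)"
  shows "\<exists>d\<in>D. \<exists>e\<in>D. if d = e then 2 \<le> c d else 1 \<le> c d \<and> 1 \<le> c e"
proof (rule ccontr)
  assume *: "\<not> ?thesis"
  have "\<exists>d\<in>D. c d \<noteq> 0" using assms(2) by (metis not_numeral_le_zero sum.neutral)
  then obtain d where d: "d \<in> D" "c d \<noteq> 0" by blast
  have "c d < 2" using * d(1) by (metis linorder_not_le)
  moreover have "c e = 0" if "e \<in> D - {d}" for e
  proof -
    have "e \<in> D" "d \<noteq> e" using that by auto
    then have "\<not> (1 \<le> c d \<and> 1 \<le> c e)" using * d(1) by metis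
    then show "c e = 0" using d by linarith
  qed
  then have "(\<Sum>e\<in>D - {d}. c e) = 0" by simp
  moreover have "(\<Sum>e\<in>D. c e) = c d + (\<Sum>e\<in>D - {d}. c e)" using assms(1) d by (intro sum.remove)
  ultimately show False using assms(2) by linarith
qed

context mean_field_system
begin

lemma measure_quarter_plane:
  assumes "c > 0" "B \<in> sets borel" "B \<subseteq> quadrant"
  shows "emeasure (quarter_plane c) B = ennreal c * emeasure lborel B"
    "measure (quarter_plane c) B = c * measure lborel B"
  using assms quadrant_borel
  by (simp_all add: quarter_plane_def measure_def emeasure_scale_measure emeasure_restrict_space enn2real_mult)

lemma measure_half_line:
  assumes "c > 0" "B \<in> sets borel" "B \<subseteq> {0..}"
  shows "emeasure (half_line c) B = ennreal c * emeasure lborel B"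
    "measure (half_line c) B = c * measure lborel B"
  using assms
  by (simp_all add: half_line_def measure_def emeasure_scale_measure emeasure_restrict_space enn2real_mult)

lemma prob_Q:
  assumes d: "d \<in> active K" and B: "B \<in> sets borel" "B \<subseteq> quadrant" "bounded B"
  shows "prob {\<omega> \<in> space M. emeasure (Q d \<omega>) B = of_nat n}
    = intensity d B ^ n / fact n * exp (- intensity d B)"
proof -
  have pp: "prob {\<omega> \<in> space M. emeasure (N \<omega>) A = of_nat n} = measure \<Lambda> A ^ n / fact n * exp (- measure \<Lambda> A)"
    if "poisson_point_process M \<Lambda> N" "A \<in> sets \<Lambda>" "emeasure \<Lambda> A < \<infinity>"
    for \<Lambda> A and N :: "'w \<Rightarrow> ('e::metric_space) measure"
    using that by (auto simp: poisson_point_process_def)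
  have BQ: "B \<inter> quadrant = B" using B by blast
  have pl: "B \<in> sets (quarter_plane c)" for c using B by (simp add: sets_quarter_plane)
  have fin: "emeasure lborel B < \<infinity>" using B by (intro emeasure_bounded_finite)
  let ?L = "{s. (s, 1) \<in> B}"
  have L: "?L \<subseteq> {0..}" "?L \<in> sets borel" using B trace_borel by auto
  then have Lc: "?L \<inter> {0..} = ?L" by blast
  have li: "?L \<in> sets (half_line c)" for c using L by (simp add: sets_half_line)
  have finL: "emeasure lborel ?L < \<infinity>"
    using bounded_trace[OF B(3)] Lc by (intro emeasure_bounded_finite) simp
  from d show ?thesis
  proof (cases rule: active_cases)
    case (Lam i)
    have "{\<omega> \<in> space M. emeasure (Q d \<omega>) B = of_nat n} = {\<omega> \<in> space M. emeasure (Nlam i \<omega>) B = of_nat n}"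
      using Q_planar(1)[OF _ B(1) Lam(2)] BQ Lam(1) by auto
    then show ?thesis
      using pp[OF pp_Lam[OF Lam(2)] pl] fin Lam(1) measure_quarter_plane[OF lam_pos B(1,2)]
      by (simp add: ennreal_mult_less_top)
  next
    case (Nu i)
    have "{\<omega> \<in> space M. emeasure (Q d \<omega>) B = of_nat n} = {\<omega> \<in> space M. emeasure (Nnu i \<omega>) B = of_nat n}"
      using Q_planar(2)[OF _ B(1) Nu(2)] BQ Nu(1) by auto
    then show ?thesis
      using pp[OF pp_Nu[OF Nu(2)] pl] fin Nu(1) measure_quarter_plane[OF nu_pos B(1,2)]
      by (simp add: ennreal_mult_less_top)
  next
    case (Mu l)
    have "{\<omega> \<in> space M. emeasure (Q d \<omega>) B = of_nat n} = {\<omega> \<in> space M. emeasure (Nmu l \<omega>) ?L = of_nat n}"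
      using Q_linear[OF _ B(1) Mu(2)] Lc Mu(1) by auto
    then show ?thesis
      using pp[OF pp_Mu[OF Mu(2)] li] finL Mu(1) measure_half_line[OF mu_pos L(2,1)]
      by (simp add: ennreal_mult_less_top)
  qed
qed

abbreviation box :: "(real \<times> real) set" where
  "box \<equiv> {0..T} \<times> {0..real K}"

lemma cnt_event [measurable]:
  assumes "d \<in> active K" "B \<in> sets borel"
  shows "(\<lambda>\<omega>. points \<omega> d B) \<in> M \<rightarrow>\<^sub>M count_space UNIV"
  using Q_measurable[OF assms] by (rule cnt_measurableI) simp

lemma intensity_nonneg: "0 \<le> intensity d B"
  using lam_pos mu_pos nu_pos by (cases d) auto

lemma prob_cnt:
  assumes d: "d \<in> active K" and B: "B \<in> sets borel" "B \<subseteq> box"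
  shows "prob {\<omega> \<in> space M. points \<omega> d B = n} = intensity d B ^ n / fact n * exp (- intensity d B)"
proof -
  have "{\<omega> \<in> space M. points \<omega> d B = n} = {\<omega> \<in> space M. emeasure (Q d \<omega>) B = of_nat n}"
    using cnt_eq[OF _ assms] by auto
  moreover have "bounded B" "B \<subseteq> quadrant"
    using B(2) bounded_subset[OF bounded_Times[OF bounded_closed_interval bounded_closed_interval] B(2)]
    by auto
  ultimately show ?thesis using prob_Q[OF d B(1)] by simp
qed

lemma prob_cnt_nonzero:
  assumes d: "d \<in> active K" and B: "B \<in> sets borel" "B \<subseteq> box"
  shows "prob {\<omega> \<in> space M. 1 \<le> points \<omega> d B} \<le> intensity d B"
proof -
  note [measurable] = cnt_event[OF d B(1)]
  have "{\<omega> \<in> space M. 1 \<le> points \<omega> d B} = space M - {\<omega> \<in> space M. points \<omega> d B = 0}" by auto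
  also have "prob \<dots> = 1 - prob {\<omega> \<in> space M. points \<omega> d B = 0}"
    by (rule prob_compl) measurable
  also have "\<dots> = 1 - exp (- intensity d B)" using prob_cnt[OF assms, of 0] by simp
  also have "\<dots> \<le> intensity d B" using exp_ge_add_one_self[of "- intensity d B"] by simp
  finally show ?thesis .
qed

lemma prob_cnt_multiple:
  assumes d: "d \<in> active K" and B: "B \<in> sets borel" "B \<subseteq> box"
  shows "prob {\<omega> \<in> space M. 2 \<le> points \<omega> d B} \<le> (intensity d B)\<^sup>2"
proof -
  note [measurable] = cnt_event[OF d B(1)]
  let ?m = "intensity d B"
  have "{\<omega> \<in> space M. 2 \<le> points \<omega> d B}
    = space M - ({\<omega> \<in> space M. points \<omega> d B = 0} \<union> {\<omega> \<in> space M. points \<omega> d B = 1})" by auto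
  also have "prob \<dots> = 1 - prob ({\<omega> \<in> space M. points \<omega> d B = 0} \<union> {\<omega> \<in> space M. points \<omega> d B = 1})"
    by (rule prob_compl) measurable
  also have "prob ({\<omega> \<in> space M. points \<omega> d B = 0} \<union> {\<omega> \<in> space M. points \<omega> d B = 1})
    = prob {\<omega> \<in> space M. points \<omega> d B = 0} + prob {\<omega> \<in> space M. points \<omega> d B = 1}"
    by (rule finite_measure_Union) auto
  also have "\<dots> = exp (- ?m) * (1 + ?m)"
    using prob_cnt[OF assms, of 0] prob_cnt[OF assms, of 1] by (simp add: algebra_simps)
  also have "1 - exp (- ?m) * (1 + ?m) \<le> 1 - (1 - ?m) * (1 + ?m)"
    using exp_ge_add_one_self[of "- ?m"] intensity_nonneg[of d B] by (simp add: mult_right_mono)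
  also have "\<dots> = ?m\<^sup>2" by (simp add: algebra_simps power2_eq_square)
  finally show ?thesis by simp
qed

text \<open>Independence of different drivers gives the same quadratic order that
  \<open>prob_cnt_multiple\<close> gives for one driver.\<close>

lemma prob_cnt_both:
  assumes d: "d \<in> active K" and e: "e \<in> active K" and "d \<noteq> e"
    and B: "B \<in> sets borel" "B \<subseteq> box"
  shows "prob {\<omega> \<in> space M. 1 \<le> points \<omega> d B \<and> 1 \<le> points \<omega> e B} \<le> intensity d B * intensity e B"
proof -
  let ?A = "\<lambda>d. {\<omega> \<in> space M. 1 \<le> points \<omega> d B}"
  have mem: "?A d \<in> sets (driver_algebra {0..} d)" if d: "d \<in> active K" for d
  proof -
    have [measurable]: "(\<lambda>\<omega>. points \<omega> d B) \<in> driver_algebra {0..} d \<rightarrow>\<^sub>M count_space UNIV"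
      using B d by (intro cnt_measurableI Q_measurable_driver) (auto simp: sets_driver_algebra)
    have "{\<omega> \<in> space (driver_algebra {0..} d). 1 \<le> points \<omega> d B} \<in> sets (driver_algebra {0..} d)"
      by measurable
    then show ?thesis by (simp add: sets_driver_algebra)
  qed
  have "prob (\<Inter>j\<in>{d, e}. ?A j) = (\<Prod>j\<in>{d, e}. prob (?A j))"
    using mem d e active_drivers by (intro indep_setsD[OF driver_indep]) auto
  moreover have "(\<Inter>j\<in>{d, e}. ?A j) = {\<omega> \<in> space M. 1 \<le> points \<omega> d B \<and> 1 \<le> points \<omega> e B}" by auto
  ultimately have "prob {\<omega> \<in> space M. 1 \<le> points \<omega> d B \<and> 1 \<le> points \<omega> e B} = prob (?A d) * prob (?A e)"
    using \<open>d \<noteq> e\<close> by simp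
  also have "\<dots> \<le> intensity d B * intensity e B"
    using prob_cnt_nonzero[OF d B] prob_cnt_nonzero[OF e B] intensity_nonneg
    by (intro mult_mono) auto
  finally show ?thesis .
qed

text \<open>One linear bound for all drivers. A \<open>Mu\<close> driver sees only the trace at
  height \<open>1\<close>, an interval of length \<open>b - a\<close>, and \<open>K \<ge> 1\<close>
  makes this at most the area of the strip.\<close>

lemma intensity_strip:
  assumes "0 \<le> a" "a \<le> b"
  shows "intensity d ({a<..b} \<times> {0..real K}) \<le> (lam + nu + mu) * real K * (b - a)"
proof -
  let ?y = "(b - a) * real K"
  have 1: "measure lborel ({a<..b} \<times> {0..real K}) = ?y"
    using measure_rectangle(1)[of a b 0 "real K"] assms by simp
  have "{s. (s, 1) \<in> {a<..b} \<times> {0..real K}} = {a<..b}" using K_pos by auto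
  then have 2: "measure lborel {s. (s, 1) \<in> {a<..b} \<times> {0..real K}} = b - a" using assms by simp
  have y: "b - a \<le> ?y" "0 \<le> ?y"
    using K_pos assms by (simp_all add: mult_le_cancel_left1)
  have "intensity d ({a<..b} \<times> {0..real K}) \<le> (lam + nu + mu) * ?y"
  proof (cases d)
    case (Mu l)
    have "mu * (b - a) \<le> mu * ?y" using y mu_pos by (intro mult_left_mono) auto
    also have "\<dots> \<le> (lam + nu + mu) * ?y" using y lam_pos nu_pos by (intro mult_right_mono) auto
    finally show ?thesis unfolding Mu intensity.simps 2 .
  qed (use 1 y lam_pos nu_pos mu_pos in \<open>simp_all add: mult_right_mono\<close>)
  then show ?thesis by (simp add: mult_ac)
qed


section \<open>Almost sure regularity of the point configuration\<close>

lemma AE_cnt_eq_0: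
  assumes d: "d \<in> active K" and B: "B \<in> sets borel" "B \<subseteq> box" and 0: "intensity d B = 0"
  shows "AE \<omega> in M. points \<omega> d B = 0"
proof -
  note [measurable] = cnt_event[OF d B(1)]
  have ev: "{\<omega> \<in> space M. 1 \<le> points \<omega> d B} \<in> events" by measurable
  have "prob {\<omega> \<in> space M. 1 \<le> points \<omega> d B} = 0"
    using prob_cnt_nonzero[OF d B] 0 measure_nonneg[of M] by (simp add: order_antisym)
  then have "AE \<omega> in M. \<omega> \<notin> {\<omega> \<in> space M. 1 \<le> points \<omega> d B}"
    using prob_eq_0[OF ev] by blast
  with AE_space show ?thesis by eventually_elim auto
qed

lemma AE_no_point_at_0: "AE \<omega> in M. \<forall>d\<in>active K. points \<omega> d ({0} \<times> {0..real K}) = 0"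
proof (subst AE_finite_all[OF finite_active], intro ballI AE_cnt_eq_0)
  fix d
  have "measure lborel ({0..0::real} \<times> {0..real K}) = (0 - 0) * (real K - 0)"
    by (rule measure_rectangle(2)) auto
  then have "measure lborel ({0::real} \<times> {0..real K}) = 0" by simp
  moreover have "{s. (s, 1) \<in> {0::real} \<times> {0..real K}} = {0}" using K_pos by auto
  ultimately show "intensity d ({0} \<times> {0..real K}) = 0" by (cases d) simp_all
qed (use T_pos in auto)

lemma AE_no_point_at_height_0: "AE \<omega> in M. \<forall>d\<in>active K. points \<omega> d ({0..T} \<times> {0}) = 0"
proof (subst AE_finite_all[OF finite_active], intro ballI AE_cnt_eq_0)
  fix d
  have "measure lborel ({0..T} \<times> {0..0::real}) = 0"
    using measure_rectangle(2)[of 0 T 0 0] T_pos by simp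
  moreover have "{s. (s, 1::real) \<in> {0..T} \<times> {0}} = {}" by auto
  ultimately show "intensity d ({0..T} \<times> {0}) = 0" by (cases d) simp_all
qed auto

text \<open>
  A multiple point would put two points into one of the \<open>n\<close> strips of width \<open>T / n\<close>, which has
  probability \<open>O(n (1/n)\<^sup>2)\<close>.
\<close>

lemma AE_no_multiple_points:
  "AE \<omega> in M. \<forall>s\<in>{0<..T}. (\<Sum>d\<in>active K. points \<omega> d ({s} \<times> {0..real K})) \<le> 1"
proof -
  define cell where "cell n k = {T * real k / real n<..T * real (Suc k) / real n} \<times> {0..real K}"
    for n k :: nat
  define c where "c = (lam + nu + mu) * real K"
  have c: "0 \<le> c" using lam_pos nu_pos mu_pos by (simp add: c_def)
  define E where "E n = (\<Union>k<n. {\<omega> \<in> space M. 2 \<le> (\<Sum>d\<in>active K. points \<omega> d (cell n k))})" for n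
  have cell: "cell n k \<in> sets borel" "cell n k \<subseteq> box" "intensity d (cell n k) \<le> c * T / real n"
    if "k < n" for n k d
  proof -
    show "cell n k \<in> sets borel" unfolding cell_def by (rule rectangle_borel) auto
    have "T * real (Suc k) \<le> T * real n" using that T_pos by (intro mult_left_mono) auto
    then have 1: "T * real (Suc k) / real n \<le> T" using that by (simp add: divide_le_eq)
    have 0: "0 \<le> T * real k / real n" using T_pos by simp
    show "cell n k \<subseteq> box" using 0 1 by (auto simp: cell_def simp del: of_nat_Suc)
    have diff: "T * real (Suc k) / real n - T * real k / real n = T / real n"
      by (simp add: field_simps add_divide_distrib)
    have le: "T * real k / real n \<le> T * real (Suc k) / real n"
      using T_pos by (intro divide_right_mono mult_left_mono) auto
    show "intensity d (cell n k) \<le> c * T / real n"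
      using intensity_strip[OF 0 le, of d] unfolding cell_def c_def diff by simp
  qed
  have cell_event: "{\<omega> \<in> space M. 2 \<le> (\<Sum>d\<in>active K. points \<omega> d (cell n k))} \<in> events" if "k < n" for n k
  proof -
    have "(\<lambda>\<omega>. \<Sum>d\<in>active K. points \<omega> d (cell n k)) \<in> M \<rightarrow>\<^sub>M count_space UNIV"
      using cell(1)[OF that]
      by (intro measurable_finitely_many_coordinates[OF finite_active, where h = "\<lambda>a. \<Sum>d\<in>active K. a d"])
        (auto intro!: cnt_event sum.cong)
    then show ?thesis by measurable
  qed
  then have E_event: "E n \<in> events" for n unfolding E_def by auto
  have pair: "prob {\<omega> \<in> space M. if d = e then 2 \<le> points \<omega> d (cell n k)
      else 1 \<le> points \<omega> d (cell n k) \<and> 1 \<le> points \<omega> e (cell n k)} \<le> (c * T / real n)\<^sup>2"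
    if "k < n" "d \<in> active K" "e \<in> active K" for n k d e
  proof (cases "d = e")
    case True
    have "prob {\<omega> \<in> space M. 2 \<le> points \<omega> d (cell n k)} \<le> (intensity d (cell n k))\<^sup>2"
      using that cell[OF that(1)] by (intro prob_cnt_multiple)
    also have "\<dots> \<le> (c * T / real n)\<^sup>2"
      using cell(3)[OF that(1)] intensity_nonneg by (intro power_mono)
    finally show ?thesis using True by simp
  next
    case False
    have "prob {\<omega> \<in> space M. 1 \<le> points \<omega> d (cell n k) \<and> 1 \<le> points \<omega> e (cell n k)}
      \<le> intensity d (cell n k) * intensity e (cell n k)"
      using that cell[OF that(1)] False by (intro prob_cnt_both)
    also have "\<dots> \<le> (c * T / real n) * (c * T / real n)"
      using cell(3)[OF that(1)] intensity_nonneg c T_pos by (intro mult_mono) auto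
    finally show ?thesis using False by (simp add: power2_eq_square)
  qed
  define A where "A = real (card (active K)) ^ 2"
  have cell_prob: "prob {\<omega> \<in> space M. 2 \<le> (\<Sum>d\<in>active K. points \<omega> d (cell n k))} \<le> A * (c * T / real n)\<^sup>2"
    if k: "k < n" for n k
  proof -
    define P where "P d e = {\<omega> \<in> space M. if d = e then 2 \<le> points \<omega> d (cell n k)
      else 1 \<le> points \<omega> d (cell n k) \<and> 1 \<le> points \<omega> e (cell n k)}" for d e
    have P: "P d e \<in> events" if "d \<in> active K" "e \<in> active K" for d e
    proof -
      note [measurable] = cnt_event[OF that(1) cell(1)[OF k]] cnt_event[OF that(2) cell(1)[OF k]]
      show ?thesis unfolding P_def by measurable
    qed
    have "{\<omega> \<in> space M. 2 \<le> (\<Sum>d\<in>active K. points \<omega> d (cell n k))}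
      \<subseteq> (\<Union>(d, e)\<in>active K \<times> active K. P d e)"
      unfolding P_def using two_le_sum_cases[OF finite_active] by fastforce
    then have "prob {\<omega> \<in> space M. 2 \<le> (\<Sum>d\<in>active K. points \<omega> d (cell n k))}
      \<le> prob (\<Union>(d, e)\<in>active K \<times> active K. P d e)"
      using P by (intro finite_measure_mono sets.finite_UN) auto
    also have "\<dots> \<le> (\<Sum>(d, e)\<in>active K \<times> active K. prob (P d e))"
    proof -
      have "(\<lambda>(d, e). P d e) ` (active K \<times> active K) \<subseteq> events" using P by auto
      from finite_measure_subadditive_finite[OF _ this] show ?thesis by (simp add: case_prod_unfold)
    qed
    also have "\<dots> \<le> (\<Sum>(d, e)\<in>active K \<times> active K. (c * T / real n)\<^sup>2)"
      by (intro sum_mono) (use pair[OF k, folded P_def] in auto)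
    also have "\<dots> = A * (c * T / real n)\<^sup>2"
      by (simp add: A_def card_cartesian_product power2_eq_square)
    finally show ?thesis .
  qed
  have E_prob: "prob (E n) \<le> A * (c * T)\<^sup>2 / real n" if "n > 0" for n
  proof -
    have "prob (E n) \<le> (\<Sum>k<n. prob {\<omega> \<in> space M. 2 \<le> (\<Sum>d\<in>active K. points \<omega> d (cell n k))})"
      unfolding E_def using cell_event by (intro finite_measure_subadditive_finite) auto
    also have "\<dots> \<le> (\<Sum>k<n. A * (c * T / real n)\<^sup>2)"
      using cell_prob by (intro sum_mono) simp
    also have "\<dots> = A * (c * T)\<^sup>2 / real n"
      using that by (simp add: power2_eq_square field_simps)
    finally show ?thesis .
  qed
  \<comment> \<open>\<open>E 0\<close> is an empty union, so the intersection starts at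
    \<open>n = 1\<close>: an outcome with a multiple point lies in every \<open>E n\<close> with
    \<open>n \<ge> 1\<close>.\<close>
  let ?N = "\<Inter>n. E (Suc n)"
  have N_event: "?N \<in> events" using E_event by auto
  have "prob ?N \<le> 0"
  proof (rule LIMSEQ_le_const)
    show "(\<lambda>n. A * (c * T)\<^sup>2 / real n) \<longlonglongrightarrow> 0" by (rule lim_const_over_n)
    show "\<exists>m. \<forall>n\<ge>m. prob ?N \<le> A * (c * T)\<^sup>2 / real n"
    proof (intro exI[of _ 1] allI impI)
      fix n :: nat assume n: "1 \<le> n"
      have "?N \<subseteq> E (Suc (n - 1))" by blast
      then have "prob ?N \<le> prob (E n)" using n E_event by (intro finite_measure_mono) auto
      then show "prob ?N \<le> A * (c * T)\<^sup>2 / real n" using E_prob[of n] n by linarith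
    qed
  qed
  then have "prob ?N = 0" using measure_nonneg[of M ?N] by linarith
  then have "AE \<omega> in M. \<omega> \<notin> ?N" using prob_eq_0[OF N_event] by blast
  with AE_space show ?thesis
  proof eventually_elim
    case (elim \<omega>)
    interpret cf: configuration "\<lambda>d. Q d \<omega>" K T by (rule configuration) (use elim in simp)
    show ?case
    proof (intro ballI leI notI)
      fix s assume s: "s \<in> {0<..T}" and many: "1 < (\<Sum>d\<in>active K. points \<omega> d ({s} \<times> {0..real K}))"
      have "\<omega> \<in> E (Suc m)" for m
      proof -
        define n where "n = Suc m"
        \<comment> \<open>The strips are open on the left and closed on the right, so the one
          containing \<open>s\<close> is found by rounding up and subtracting
          \<open>1\<close>.\<close>
        define k where "k = nat (\<lceil>s * real n / T\<rceil> - 1)"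
        have pos: "0 < s * real n / T" using s T_pos by (simp add: n_def)
        have "s * real n / T \<le> real n" using s T_pos 
          by (simp add: divide_le_eq) (simp add: mult.commute[of _ T] mult_right_mono)
        then have "\<lceil>s * real n / T\<rceil> \<le> int n" by (simp add: ceiling_le_iff)
        moreover have "1 \<le> \<lceil>s * real n / T\<rceil>" using pos by (simp add: one_le_ceiling)
        ultimately have k: "k < n" "real (Suc k) = of_int \<lceil>s * real n / T\<rceil>"
          unfolding k_def by linarith+
        have "real k < s * real n / T" "s * real n / T \<le> real (Suc k)"
          using k(2) ceiling_correct[of "s * real n / T"] by simp_all
        then have "T * real k / real n < s" "s \<le> T * real (Suc k) / real n"
          using T_pos by (simp_all add: n_def field_simps)
        then have sub: "{s} \<times> {0..real K} \<subseteq> cell n k" by (auto simp: cell_def simp del: of_nat_Suc)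
        have "(\<Sum>d\<in>active K. points \<omega> d ({s} \<times> {0..real K})) \<le> (\<Sum>d\<in>active K. points \<omega> d (cell n k))"
          using cell[OF k(1)] sub by (intro sum_mono cf.cnt_mono) auto
        then show ?thesis using many elim k(1) by (auto simp: E_def n_def intro!: bexI[of _ k])
      qed
      then show False using elim by blast
    qed
  qed
qed

lemma AE_simple: "AE \<omega> in M. configuration.simple (\<lambda>d. Q d \<omega>) K T"
  using AE_space AE_no_multiple_points AE_no_point_at_height_0
proof eventually_elim
  case (elim \<omega>)
  interpret cf: configuration "\<lambda>d. Q d \<omega>" K T by (rule configuration) (use elim in simp)
  show ?case using elim cf.events_subset unfolding cf.simple_def by blast
qed

end

section \<open>Measurability of left limits\<close>

text \<open>For \<open>n > 0\<close> and \<open>s > 0\<close> this is the largest multiple of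
  \<open>1 / real n\<close> strictly below \<open>s\<close>, so values along the grid reach the left
  limit rather than the value at \<open>s\<close>. At \<open>s = 0\<close> the maximum gives
  \<open>0\<close>, in line with \<open>left_lim\<close>.\<close>

definition grid :: "nat \<Rightarrow> real \<Rightarrow> real" where
  "grid n s = max 0 ((of_int \<lceil>real n * s\<rceil> - 1) / real n)"

text \<open>Extends functions known on \<open>{0..T}\<close> to the whole line, so that
  measurability can be stated for total functions.\<close>

definition confine :: "real \<Rightarrow> real \<Rightarrow> real" where
  "confine T s = min (max s 0) T"

lemma confine_in: "0 \<le> T \<Longrightarrow> confine T s \<in> {0..T}"
  and confine_eq: "s \<in> {0..T} \<Longrightarrow> confine T s = s"
  by (auto simp: confine_def)

lemma grid_bounds:
  assumes "n > 0" "s > 0"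
  shows "grid n s < s" "s - 1 / real n \<le> grid n s"
proof -
  have "of_int \<lceil>real n * s\<rceil> - 1 < real n * s" "real n * s \<le> of_int \<lceil>real n * s\<rceil>"
    using ceiling_correct[of "real n * s"] by simp_all
  then have "(of_int \<lceil>real n * s\<rceil> - 1) / real n < s" "s - 1 / real n \<le> (of_int \<lceil>real n * s\<rceil> - 1) / real n"
    using assms by (simp_all add: field_simps)
  then show "grid n s < s" "s - 1 / real n \<le> grid n s" using assms by (simp_all add: grid_def)
qed

lemma grid_0: "grid n 0 = 0"
  by (simp add: grid_def)

lemma grid_in: "n > 0 \<Longrightarrow> s \<in> {0..T} \<Longrightarrow> grid n s \<in> {0..T}"
  using grid_bounds(1)[of n s] by (cases "s = 0") (auto simp: grid_0, auto simp: grid_def)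

lemma eventually_grid:
  fixes f :: "real \<Rightarrow> state"
  assumes f: "f \<in> cadlag_paths T E" and s: "s \<in> {0..T}"
  shows "\<forall>\<^sub>F n in sequentially. f (grid n s) = left_lim f s"
proof (cases "s = 0")
  case False
  then have s: "s \<in> {0<..T}" "0 < s" using s by auto
  obtain b where b: "b < s" "\<And>u. b < u \<Longrightarrow> u < s \<Longrightarrow> f u = left_lim f s"
    using left_lim_eventually[OF f s(1)] unfolding eventually_at_left_field by blast
  have "\<forall>\<^sub>F n in sequentially. 1 / real n < s - b"
    using b(1) by (intro order_tendstoD(2)[OF lim_const_over_n]) simp
  with eventually_gt_at_top[of 0] show ?thesis
  proof eventually_elim
    case (elim n)
    then show ?case using grid_bounds[OF elim(1) s(2)] by (intro b(2)) auto
  qed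
qed (simp add: grid_0 left_lim_def)

text \<open>The argument enters only through an integer, so \<open>g\<close> may be an arbitrary
  function with values in \<open>space N\<close>.\<close>

lemma grid_step_measurable: "(\<lambda>s. g (grid n (confine T s))) \<in> borel \<rightarrow>\<^sub>M N" if "range g \<subseteq> space N" for g
proof -
  have "(\<lambda>s. \<lceil>real n * confine T s\<rceil>) \<in> borel \<rightarrow>\<^sub>M count_space UNIV"
    unfolding confine_def by measurable
  moreover have "(\<lambda>i. g (max 0 ((of_int i - 1) / real n))) \<in> count_space UNIV \<rightarrow>\<^sub>M N"
    using that by (auto simp: Pi_iff)
  ultimately show ?thesis unfolding grid_def by (rule measurable_compose)
qed

lemma left_lim_measurable:
  fixes f :: "real \<Rightarrow> state"
  assumes "f \<in> cadlag_paths T E" "0 \<le> T"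
  shows "(\<lambda>s. left_lim f (confine T s)) \<in> borel \<rightarrow>\<^sub>M count_space UNIV"
  by (rule measurable_eventually_eq[where f = "\<lambda>n s. f (grid n (confine T s))"])
    (use eventually_grid[OF assms(1) confine_in[OF assms(2)]] in \<open>auto intro!: grid_step_measurable\<close>)

context prob_space
begin

lemma process_left_lim_measurable:
  fixes X :: "real \<Rightarrow> 'a \<Rightarrow> state"
  assumes X: "\<And>t. t \<in> {0..T} \<Longrightarrow> X t \<in> M \<rightarrow>\<^sub>M count_space UNIV"
    and paths: "\<And>\<omega>. \<omega> \<in> space M \<Longrightarrow> (\<lambda>t. X t \<omega>) \<in> cadlag_paths T E"
    and s: "s \<in> {0..T}"
  shows "(\<lambda>\<omega>. left_lim (\<lambda>u. X u \<omega>) s) \<in> M \<rightarrow>\<^sub>M count_space UNIV"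
proof (rule measurable_eventually_eq)
  show "(\<lambda>\<omega>. X (grid (Suc n) s) \<omega>) \<in> M \<rightarrow>\<^sub>M count_space UNIV" for n
    using X[OF grid_in[OF _ s]] by simp
  fix \<omega> assume "\<omega> \<in> space M"
  from eventually_grid[OF paths[OF this] s]
  show "\<forall>\<^sub>F n in sequentially. X (grid (Suc n) s) \<omega> = left_lim (\<lambda>u. X u \<omega>) s"
    by (rule eventually_sequentially_Suc[THEN iffD2])
qed

text \<open>Along \<open>grid\<close> the probability is a step function of time, hence measurable
  without joint measurability of \<open>X\<close> in time and outcome; dominated convergence passes
  to the left limit.\<close>

lemma prob_left_lim_measurable:
  fixes X :: "real \<Rightarrow> 'a \<Rightarrow> state"
  assumes X: "\<And>t. t \<in> {0..T} \<Longrightarrow> X t \<in> M \<rightarrow>\<^sub>M count_space UNIV"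
    and paths: "\<And>\<omega>. \<omega> \<in> space M \<Longrightarrow> (\<lambda>t. X t \<omega>) \<in> cadlag_paths T E"
    and T: "0 \<le> T"
  shows "(\<lambda>s. prob {\<omega> \<in> space M. left_lim (\<lambda>u. X u \<omega>) (confine T s) \<in> A}) \<in> borel_measurable borel"
proof (rule borel_measurable_LIMSEQ_real)
  let ?g = "\<lambda>u. prob {\<omega> \<in> space M. X u \<omega> \<in> A}"
  show "(\<lambda>s. ?g (grid (Suc n) (confine T s))) \<in> borel_measurable borel" for n
    by (rule grid_step_measurable) simp
  fix s :: real
  let ?s = "confine T s"
  have sT: "?s \<in> {0..T}" using T by (rule confine_in)
  let ?E = "{\<omega> \<in> space M. left_lim (\<lambda>u. X u \<omega>) ?s \<in> A}"
  let ?En = "\<lambda>n. {\<omega> \<in> space M. X (grid (Suc n) ?s) \<omega> \<in> A}"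
  note [measurable] = process_left_lim_measurable[OF X paths sT]
  have [measurable]: "X (grid (Suc n) ?s) \<in> M \<rightarrow>\<^sub>M count_space UNIV" for n
    using X[OF grid_in[OF _ sT]] by simp
  have "(\<lambda>n. \<integral>\<omega>. indicat_real (?En n) \<omega> \<partial>M) \<longlonglongrightarrow> (\<integral>\<omega>. indicat_real ?E \<omega> \<partial>M)"
  proof (rule integral_dominated_convergence[where w = "\<lambda>_. 1"])
    show "AE \<omega> in M. (\<lambda>n. indicat_real (?En n) \<omega>) \<longlonglongrightarrow> indicat_real ?E \<omega>"
    proof (rule AE_I2)
      fix \<omega> assume \<omega>: "\<omega> \<in> space M"
      have "\<forall>\<^sub>F n in sequentially. X (grid (Suc n) ?s) \<omega> = left_lim (\<lambda>u. X u \<omega>) ?s"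
        using eventually_grid[OF paths[OF \<omega>] sT] by (rule eventually_sequentially_Suc[THEN iffD2])
      then have "\<forall>\<^sub>F n in sequentially. indicat_real (?En n) \<omega> = indicat_real ?E \<omega>"
        by eventually_elim (auto simp: indicator_def)
      then show "(\<lambda>n. indicat_real (?En n) \<omega>) \<longlonglongrightarrow> indicat_real ?E \<omega>"
        by (rule tendsto_eventually)
    qed
  qed (auto simp: indicator_def)
  then show "(\<lambda>n. ?g (grid (Suc n) ?s)) \<longlonglongrightarrow> prob ?E" by simp
qed

end

section \<open>The fixed point problem for the acceptance probabilities\<close>

text \<open>The intervals of radius \<open>r n = 2 * c * (1/2) ^ n\<close> around \<open>x n\<close>
  are nested, because \<open>r n - r (Suc n)\<close> is exactly the bound on the increment. The
  radius is the tail of the geometric series.\<close>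

lemma geometric_increments_limit:
  fixes x :: "nat \<Rightarrow> real"
  assumes "\<And>n. \<bar>x (Suc n) - x n\<bar> \<le> c * (1/2) ^ n"
  shows "convergent x" and "\<bar>x n - lim x\<bar> \<le> 2 * c * (1/2) ^ n"
proof -
  define r where "r n = 2 * c * (1/2) ^ n" for n :: nat
  have "0 \<le> c" using assms[of 0] by simp
  then have r0: "0 \<le> r n" for n by (simp add: r_def)
  have rS: "c * (1/2) ^ n = r n - r (Suc n)" for n by (simp add: r_def)
  have r_lim: "r \<longlonglongrightarrow> 0"
    unfolding r_def using tendsto_mult_left[OF LIMSEQ_power_zero[of "1/2 :: real"], of "2 * c"] by simp
  have "\<exists>l. ((\<forall>n. x n - r n \<le> l) \<and> (\<lambda>n. x n - r n) \<longlonglongrightarrow> l) \<and>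
    ((\<forall>n. l \<le> x n + r n) \<and> (\<lambda>n. x n + r n) \<longlonglongrightarrow> l)"
  proof (rule nested_sequence_unique)
    show "\<forall>n. x n - r n \<le> x (Suc n) - r (Suc n)" "\<forall>n. x (Suc n) + r (Suc n) \<le> x n + r n"
      using assms unfolding rS abs_le_iff by (smt (verit))+
    show "\<forall>n. x n - r n \<le> x n + r n" using r0 by simp
    show "(\<lambda>n. (x n - r n) - (x n + r n)) \<longlonglongrightarrow> 0"
      using tendsto_mult_left[OF r_lim, of "- 2"] by simp
  qed
  then obtain l where l: "\<And>n. x n - r n \<le> l" "\<And>n. l \<le> x n + r n" "(\<lambda>n. x n - r n) \<longlonglongrightarrow> l"
    by blast
  have "x \<longlonglongrightarrow> l" using tendsto_add[OF l(3) r_lim] by simp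
  then have "convergent x" "lim x = l" by (auto simp: convergent_def limI)
  moreover have "\<bar>x n - l\<bar> \<le> r n" using l(1,2)[of n] by linarith
  ultimately show "convergent x" "\<bar>x n - lim x\<bar> \<le> 2 * c * (1/2) ^ n" by (simp_all add: r_def)
qed

lemma eq_if_geometrically_close:
  fixes a b :: real
  assumes "\<And>n. \<bar>a - b\<bar> \<le> c * (1/2) ^ n"
  shows "a = b"
proof -
  have "(\<lambda>n. c * (1/2) ^ n) \<longlonglongrightarrow> 0"
    using tendsto_mult_left[OF LIMSEQ_power_zero[of "1/2 :: real"], of c] by simp
  then have "\<bar>a - b\<bar> \<le> 0" using assms by (intro LIMSEQ_le_const) auto
  then show ?thesis by simp
qed

text \<open>The coupling inequality: it converts agreement of paths off a small event into closeness
  of their laws.\<close>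

lemma (in prob_space) prob_diff_le:
  assumes "A \<in> events" "B \<in> events" "D \<in> events"
    and "AE \<omega> in M. \<omega> \<notin> D \<longrightarrow> (\<omega> \<in> A \<longleftrightarrow> \<omega> \<in> B)"
  shows "\<bar>prob A - prob B\<bar> \<le> prob D"
proof -
  have "prob A \<le> prob (B \<union> D)"
    using assms by (intro finite_measure_mono_AE) (auto elim: eventually_mono)
  moreover have "prob B \<le> prob (A \<union> D)"
    using assms by (intro finite_measure_mono_AE) (auto elim: eventually_mono)
  moreover have "prob (B \<union> D) \<le> prob B + prob D" "prob (A \<union> D) \<le> prob A + prob D"
    using assms by (auto intro: measure_Un_le)
  ultimately show ?thesis by linarith
qed

definition busy :: "state set" where
  "busy = {(w, x, y, z). y > 0}"

definition nonfull :: "nat \<Rightarrow> state set" where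
  "nonfull K = {(w, x, y, z). w + x + y + z < K}"

context mean_field_system
begin

section \<open>Systems with prescribed acceptance probabilities and the contraction of laws\<close>

definition admissible :: "(real \<Rightarrow> 'w \<Rightarrow> state) \<Rightarrow> bool" where
  "admissible X \<longleftrightarrow> (\<forall>t\<in>{0..T}. X t \<in> filtration t \<rightarrow>\<^sub>M count_space UNIV) \<and>
     (\<forall>\<omega>\<in>space M. (\<lambda>t. X t \<omega>) \<in> cadlag_paths T (Sigma_K K))"

text \<open>The decoupled system: \<open>p\<close> is an arbitrary input. The McKean--Vlasov
  condition is recovered by setting \<open>p = law X\<close>.\<close>

definition driven :: "(real \<Rightarrow> real \<times> real) \<Rightarrow> state \<Rightarrow> (real \<Rightarrow> 'w \<Rightarrow> state) \<Rightarrow> bool" where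
  "driven p x0 X \<longleftrightarrow> admissible X \<and>
     (AE \<omega> in M. configuration.flow (\<lambda>d. Q d \<omega>) K T p x0 (\<lambda>t. X t \<omega>))"

definition law :: "(real \<Rightarrow> 'w \<Rightarrow> state) \<Rightarrow> real \<Rightarrow> real \<times> real" where
  "law X s = (prob {\<omega> \<in> space M. left_lim (\<lambda>u. X u \<omega>) (confine T s) \<in> busy},
     prob {\<omega> \<in> space M. left_lim (\<lambda>u. X u \<omega>) (confine T s) \<in> nonfull K})"

definition probabilities :: "(real \<Rightarrow> real \<times> real) \<Rightarrow> bool" where
  "probabilities p \<longleftrightarrow> unit_valued p \<and> p \<in> borel_measurable borel"

lemma probabilitiesD:
  assumes "probabilities p"
  shows "unit_valued p" "p \<in> borel_measurable borel"
    "(\<lambda>s. fst (p s)) \<in> borel_measurable borel" "(\<lambda>s. snd (p s)) \<in> borel_measurable borel"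
proof -
  show p: "unit_valued p" "p \<in> borel_measurable borel" using assms by (auto simp: probabilities_def)
  show "(\<lambda>s. fst (p s)) \<in> borel_measurable borel" "(\<lambda>s. snd (p s)) \<in> borel_measurable borel"
    using p(2) unfolding borel_prod[symmetric] by simp_all
qed

lemma probabilitiesI:
  assumes "\<And>s. 0 \<le> f s" "\<And>s. f s \<le> 1" "\<And>s. 0 \<le> g s" "\<And>s. g s \<le> 1"
    and "f \<in> borel_measurable borel" "g \<in> borel_measurable borel"
  shows "probabilities (\<lambda>s. (f s, g s))"
  using assms unfolding probabilities_def unit_valued_def
  by (auto intro!: borel_measurable_Pair)

lemma admissibleD:
  assumes "admissible X"
  shows "t \<in> {0..T} \<Longrightarrow> X t \<in> M \<rightarrow>\<^sub>M count_space UNIV"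
    and "\<omega> \<in> space M \<Longrightarrow> (\<lambda>t. X t \<omega>) \<in> cadlag_paths T (Sigma_K K)"
  using assms adapted_measurable[of "X t" t] by (auto simp: admissible_def)

lemma probabilities_law: "admissible X \<Longrightarrow> probabilities (law X)"
  unfolding law_def using T_pos
  by (intro probabilitiesI prob_left_lim_measurable[where E = "Sigma_K K"] admissibleD) auto

lemma driven_process:
  assumes "probabilities p" "x0 \<in> Sigma_K K"
  shows "driven p x0 (process p x0)"
proof -
  note p = probabilitiesD(1,2)[OF assms(1)]
  have "AE \<omega> in M. configuration.flow (\<lambda>d. Q d \<omega>) K T p x0 (\<lambda>t. process p x0 t \<omega>)"
    using AE_simple AE_space
  proof eventually_elim
    case (elim \<omega>)
    then show ?case
      unfolding process_def using configuration.path_flow[OF configuration _ p assms(2)] by simp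
  qed
  then show ?thesis
    using process_adapted[OF p assms(2)] process_cadlag[OF assms(2)]
    by (auto simp: driven_def admissible_def)
qed

text \<open>A flow evaluates \<open>p\<close> only at events, which lie in \<open>{0<..T}\<close>.
  This is needed because the fixed point property is derived only on \<open>{0..T}\<close>.\<close>

lemma driven_cong:
  assumes "driven p x0 X" "\<And>s. s \<in> {0..T} \<Longrightarrow> p s = q s"
  shows "driven q x0 X"
proof -
  have "AE \<omega> in M. configuration.flow (\<lambda>d. Q d \<omega>) K T p x0 (\<lambda>t. X t \<omega>)"
    using assms(1) by (simp add: driven_def)
  with AE_space have "AE \<omega> in M. configuration.flow (\<lambda>d. Q d \<omega>) K T q x0 (\<lambda>t. X t \<omega>)"
  proof eventually_elim
    case (elim \<omega>)
    interpret cf: configuration "\<lambda>d. Q d \<omega>" K T by (rule configuration) (use elim in simp)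
    have "region K p d x {s} = region K q d x {s}" if "s \<in> cf.events" for d x s
    proof -
      have "p s = q s" using that cf.events_subset by (intro assms(2)) auto
      then have "rate K p d x s = rate K q d x s" by (cases d; cases x) auto
      then show ?thesis unfolding region_def by auto
    qed
    then have "(\<Sum>s\<in>cf.events \<inter> {..t}. points \<omega> d (region K p d (left_lim (\<lambda>t. X t \<omega>) s) {s}))
      = (\<Sum>s\<in>cf.events \<inter> {..t}. points \<omega> d (region K q d (left_lim (\<lambda>t. X t \<omega>) s) {s}))" for d t
      by (intro sum.cong) simp_all
    then show ?case using elim by (simp add: cf.flow_def)
  qed
  then show ?thesis using assms(1) by (simp add: driven_def)
qed

text \<open>Only the rates of the two \<open>Lam\<close> drivers involve \<open>p\<close>, so one
  band for each of them covers all points on which \<open>p\<close> and \<open>q\<close> can decide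
  differently.\<close>

definition disagree :: "(real \<Rightarrow> real \<times> real) \<Rightarrow> (real \<Rightarrow> real \<times> real) \<Rightarrow> real \<Rightarrow> 'w set" where
  "disagree p q t =
     {\<omega> \<in> space M. 1 \<le> points \<omega> (Lam 1) (band (\<lambda>s. fst (p s)) (\<lambda>s. fst (q s)) t)} \<union>
     {\<omega> \<in> space M. 1 \<le> points \<omega> (Lam 2) (band (\<lambda>s. snd (p s)) (\<lambda>s. snd (q s)) t)}"

lemma band_subset_box:
  assumes "t \<le> T" "\<And>s. 0 \<le> f s \<and> f s \<le> 1" "\<And>s. 0 \<le> g s \<and> g s \<le> 1"
  shows "band f g t \<subseteq> box"
proof safe
  fix s h assume "(s, h) \<in> band f g t"
  then have "0 \<le> s" "s \<le> t" "min (f s) (g s) \<le> h" "h \<le> max (f s) (g s)" by (auto simp: band_def)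
  then show "s \<in> {0..T}" "h \<in> {0..real K}"
    using assms(1) assms(2,3)[of s] K_pos by (auto simp: min_def max_def split: if_splits)
qed

lemma bands:
  assumes p: "probabilities p" and q: "probabilities q" and "t \<le> T"
  shows "band (\<lambda>s. fst (p s)) (\<lambda>s. fst (q s)) t \<in> sets borel"
    "band (\<lambda>s. snd (p s)) (\<lambda>s. snd (q s)) t \<in> sets borel"
    "band (\<lambda>s. fst (p s)) (\<lambda>s. fst (q s)) t \<subseteq> box"
    "band (\<lambda>s. snd (p s)) (\<lambda>s. snd (q s)) t \<subseteq> box"
proof -
  show "band (\<lambda>s. fst (p s)) (\<lambda>s. fst (q s)) t \<in> sets borel"
    "band (\<lambda>s. snd (p s)) (\<lambda>s. snd (q s)) t \<in> sets borel"
    using probabilitiesD(3,4)[OF p] probabilitiesD(3,4)[OF q] by (auto intro: band_borel)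
  show "band (\<lambda>s. fst (p s)) (\<lambda>s. fst (q s)) t \<subseteq> box" "band (\<lambda>s. snd (p s)) (\<lambda>s. snd (q s)) t \<subseteq> box"
    using probabilitiesD(1)[OF p] probabilitiesD(1)[OF q] assms(3)
    by (intro band_subset_box; simp add: unit_valued_def)+
qed

lemma Lam_active: "Lam 1 \<in> active K" "Lam 2 \<in> active K"
  by (auto simp: active_def)

lemma disagree_event:
  assumes "probabilities p" "probabilities q" "t \<le> T"
  shows "disagree p q t \<in> events"
proof -
  note [measurable] = cnt_event[OF Lam_active(1) bands(1)[OF assms]] cnt_event[OF Lam_active(2) bands(2)[OF assms]]
  show ?thesis unfolding disagree_def by measurable
qed

lemma prob_disagree:
  assumes p: "probabilities p" and q: "probabilities q" and t: "t \<in> {0..T}" and C: "0 \<le> C"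
    and close: "\<And>s. s \<in> {0..T} \<Longrightarrow> \<bar>fst (p s) - fst (q s)\<bar> \<le> C * exp (4 * lam * s)"
      "\<And>s. s \<in> {0..T} \<Longrightarrow> \<bar>snd (p s) - snd (q s)\<bar> \<le> C * exp (4 * lam * s)"
  shows "prob (disagree p q t) \<le> C / 2 * exp (4 * lam * t)"
proof -
  have tT: "t \<le> T" using t by simp
  note b = bands[OF p q tT]
  let ?B1 = "band (\<lambda>s. fst (p s)) (\<lambda>s. fst (q s)) t" and ?B2 = "band (\<lambda>s. snd (p s)) (\<lambda>s. snd (q s)) t"
  have 1: "measure lborel ?B1 \<le> C * exp (4 * lam * t) / (4 * lam)"
    using close(1) t lam_pos C probabilitiesD(3)[OF p] probabilitiesD(3)[OF q] by (intro area_band) auto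
  have 2: "measure lborel ?B2 \<le> C * exp (4 * lam * t) / (4 * lam)"
    using close(2) t lam_pos C probabilitiesD(4)[OF p] probabilitiesD(4)[OF q] by (intro area_band) auto
  note [measurable] = cnt_event[OF Lam_active(1) b(1)] cnt_event[OF Lam_active(2) b(2)]
  have "prob (disagree p q t) \<le> prob {\<omega> \<in> space M. 1 \<le> points \<omega> (Lam 1) ?B1}
    + prob {\<omega> \<in> space M. 1 \<le> points \<omega> (Lam 2) ?B2}"
    unfolding disagree_def by (rule measure_Un_le) measurable
  also have "\<dots> \<le> lam * measure lborel ?B1 + lam * measure lborel ?B2"
    using prob_cnt_nonzero[OF Lam_active(1) b(1,3)] prob_cnt_nonzero[OF Lam_active(2) b(2,4)] by simp
  also have "\<dots> \<le> lam * (C * exp (4 * lam * t) / (4 * lam)) + lam * (C * exp (4 * lam * t) / (4 * lam))"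
    using 1 2 lam_pos by (intro add_mono mult_left_mono) auto
  also have "\<dots> = C / 2 * exp (4 * lam * t)" using lam_pos by simp
  finally show ?thesis .
qed

text \<open>Two regions for the same state differ only at heights between the thresholds, hence
  inside a band without points. Since \<open>x\<close> is arbitrary, this feeds
  \<open>flow_unique\<close> before the two paths are known to coincide.\<close>

lemma agree_off_disagree:
  assumes \<omega>: "\<omega> \<in> space M" "\<omega> \<notin> disagree p q t" and p: "probabilities p" and q: "probabilities q"
    and "t \<le> T" and s: "0 < s" "s \<le> t" and d: "d \<in> active K" and x: "x \<in> Sigma_K K"
  shows "points \<omega> d (region K p d x {s}) = points \<omega> d (region K q d x {s})"
proof -
  interpret cf: configuration "\<lambda>d. Q d \<omega>" K T by (rule configuration[OF \<omega>(1)])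
  note b = bands[OF p q \<open>t \<le> T\<close>]
  note pD = probabilitiesD(1,2)[OF p] and qD = probabilitiesD(1,2)[OF q]
  obtain w x' y z where xx: "x = (w, x', y, z)" by (cases x)
  have box: "region K p d x {s} \<subseteq> box" "region K q d x {s} \<subseteq> box"
    using region_subset[OF pD(1) K_pos x, of "{s}" "{0..T}" d] region_subset[OF qD(1) K_pos x, of "{s}" "{0..T}" d]
      s \<open>t \<le> T\<close> by auto
  note eqI = cf.cnt_eq_up_to_null[OF d region_borel[OF pD(2)] box(1) region_borel[OF qD(2)] box(2)]
  have sing: "{s} \<in> sets borel" by simp
  consider "d = Lam 1" | "d = Lam 2" | "region K p d x {s} = region K q d x {s}"
    using d xx by (auto simp: active_def region_def)
  then show ?thesis
  proof cases
    case 1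
    have "points \<omega> d (band (\<lambda>s. fst (p s)) (\<lambda>s. fst (q s)) t) = 0"
      using \<omega> 1 by (auto simp: disagree_def)
    then show ?thesis
      by (rule eqI[OF sing sing b(1,3)]) (use 1 xx s in \<open>auto simp: region_def band_def split: if_splits\<close>)
  next
    case 2
    have "points \<omega> d (band (\<lambda>s. snd (p s)) (\<lambda>s. snd (q s)) t) = 0"
      using \<omega> 2 by (auto simp: disagree_def)
    then show ?thesis
      by (rule eqI[OF sing sing b(2,4)]) (use 2 xx s in \<open>auto simp: region_def band_def split: if_splits\<close>)
  qed simp
qed

lemma driven_agree:
  assumes X: "driven p x0 X" and Y: "driven q x0 Y" and p: "probabilities p" and q: "probabilities q"
    and t: "t \<in> {0..T}"
  shows "AE \<omega> in M. \<omega> \<notin> disagree p q t \<longrightarrow> (\<forall>s\<in>{0..t}. X s \<omega> = Y s \<omega>)"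
proof -
  have "AE \<omega> in M. configuration.flow (\<lambda>d. Q d \<omega>) K T p x0 (\<lambda>t. X t \<omega>)"
    "AE \<omega> in M. configuration.flow (\<lambda>d. Q d \<omega>) K T q x0 (\<lambda>t. Y t \<omega>)"
    using X Y by (simp_all add: driven_def)
  with AE_space show ?thesis
  proof eventually_elim
    case (elim \<omega>)
    interpret cf: configuration "\<lambda>d. Q d \<omega>" K T by (rule configuration[OF elim(1)])
    show ?case
    proof (intro impI ballI)
      fix s assume D: "\<omega> \<notin> disagree p q t" and s: "s \<in> {0..t}"
      show "X s \<omega> = Y s \<omega>"
      proof (rule cf.flow_unique[OF _ elim(2) _ elim(3)])
        show "(\<lambda>t. X t \<omega>) \<in> cadlag_paths T (Sigma_K K)" "(\<lambda>t. Y t \<omega>) \<in> cadlag_paths T (Sigma_K K)"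
          using X Y elim(1) by (auto simp: driven_def intro: admissibleD)
        show "s \<in> {0..t}" "t \<le> T" using s t by auto
        fix r d x assume "r \<in> cf.events" "r \<le> t" "d \<in> active K" "x \<in> Sigma_K K"
        then show "points \<omega> d (region K p d x {r}) = points \<omega> d (region K q d x {r})"
          using elim(1) D p q t cf.events_subset by (intro agree_off_disagree) auto
      qed
    qed
  qed
qed

text \<open>\<open>X\<close> and \<open>Y\<close> use the same drivers and are thereby coupled: off
  \<open>disagree p q t\<close> they agree on \<open>{0..t}\<close>, and so do their left limits at
  \<open>t\<close>.\<close>

lemma law_contraction:
  assumes X: "driven p x0 X" and Y: "driven q x0 Y" and p: "probabilities p" and q: "probabilities q"
    and C: "0 \<le> C" and t: "t \<in> {0..T}"
    and close: "\<And>s. s \<in> {0..T} \<Longrightarrow> \<bar>fst (p s) - fst (q s)\<bar> \<le> C * exp (4 * lam * s)"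
      "\<And>s. s \<in> {0..T} \<Longrightarrow> \<bar>snd (p s) - snd (q s)\<bar> \<le> C * exp (4 * lam * s)"
  shows "\<bar>fst (law X t) - fst (law Y t)\<bar> \<le> C / 2 * exp (4 * lam * t)"
    and "\<bar>snd (law X t) - snd (law Y t)\<bar> \<le> C / 2 * exp (4 * lam * t)"
proof -
  have XY: "admissible X" "admissible Y" using X Y by (auto simp: driven_def)
  have lim: "AE \<omega> in M. \<omega> \<notin> disagree p q t \<longrightarrow> left_lim (\<lambda>u. X u \<omega>) t = left_lim (\<lambda>u. Y u \<omega>) t"
    using driven_agree[OF X Y p q t] AE_space
  proof eventually_elim
    case (elim \<omega>)
    show ?case
    proof
      assume "\<omega> \<notin> disagree p q t"
      then have eq: "X s \<omega> = Y s \<omega>" if "s \<in> {0..t}" for s using elim that by blast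
      show "left_lim (\<lambda>u. X u \<omega>) t = left_lim (\<lambda>u. Y u \<omega>) t"
      proof (cases "t = 0")
        case True
        then show ?thesis using eq[of 0] by (simp add: left_lim_def)
      next
        case False
        then show ?thesis
          using admissibleD(2)[OF XY(1) elim(2)] admissibleD(2)[OF XY(2) elim(2)] eq t
          by (intro left_lim_cong) auto
      qed
    qed
  qed
  have *: "\<bar>prob {\<omega> \<in> space M. left_lim (\<lambda>u. X u \<omega>) t \<in> A} - prob {\<omega> \<in> space M. left_lim (\<lambda>u. Y u \<omega>) t \<in> A}\<bar>
    \<le> C / 2 * exp (4 * lam * t)" for A
  proof -
    have [measurable]: "(\<lambda>\<omega>. left_lim (\<lambda>u. X u \<omega>) t) \<in> M \<rightarrow>\<^sub>M count_space UNIV"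
      "(\<lambda>\<omega>. left_lim (\<lambda>u. Y u \<omega>) t) \<in> M \<rightarrow>\<^sub>M count_space UNIV"
      using process_left_lim_measurable[OF admissibleD(1)[OF XY(1)] admissibleD(2)[OF XY(1)] t]
        process_left_lim_measurable[OF admissibleD(1)[OF XY(2)] admissibleD(2)[OF XY(2)] t] by auto
    have "\<bar>prob {\<omega> \<in> space M. left_lim (\<lambda>u. X u \<omega>) t \<in> A} - prob {\<omega> \<in> space M. left_lim (\<lambda>u. Y u \<omega>) t \<in> A}\<bar>
      \<le> prob (disagree p q t)"
    proof (rule prob_diff_le)
      show "disagree p q t \<in> events" using t by (intro disagree_event[OF p q]) simp
      show "AE \<omega> in M. \<omega> \<notin> disagree p q t \<longrightarrow>
        (\<omega> \<in> {\<omega> \<in> space M. left_lim (\<lambda>u. X u \<omega>) t \<in> A}) = (\<omega> \<in> {\<omega> \<in> space M. left_lim (\<lambda>u. Y u \<omega>) t \<in> A})"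
        using lim by eventually_elim auto
    qed measurable
    also have "\<dots> \<le> C / 2 * exp (4 * lam * t)" using close by (intro prob_disagree[OF p q t C])
    finally show ?thesis .
  qed
  show "\<bar>fst (law X t) - fst (law Y t)\<bar> \<le> C / 2 * exp (4 * lam * t)"
    "\<bar>snd (law X t) - snd (law Y t)\<bar> \<le> C / 2 * exp (4 * lam * t)"
    using *[of busy] *[of "nonfull K"] confine_eq[OF t] by (simp_all add: law_def)
qed

text \<open>The contraction is iterated from a trivial start: two probabilities differ by at most
  \<open>1 \<le> exp (4 * lam * s)\<close>, so after \<open>n\<close> rounds the difference is at
  most \<open>(1/2) ^ n\<close> times the weight.\<close>

lemma law_fixed_point_unique:
  assumes X: "driven (law X) x0 X" and Y: "driven (law Y) x0 Y" and s: "s \<in> {0..T}"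
  shows "law X s = law Y s"
proof -
  have p: "probabilities (law X)" "probabilities (law Y)"
    using X Y by (auto simp: driven_def intro: probabilities_law)
  have "\<forall>s\<in>{0..T}. \<bar>fst (law X s) - fst (law Y s)\<bar> \<le> (1/2) ^ n * exp (4 * lam * s) \<and>
     \<bar>snd (law X s) - snd (law Y s)\<bar> \<le> (1/2) ^ n * exp (4 * lam * s)" for n
  proof (induction n)
    case 0
    show ?case
    proof
      fix s assume "s \<in> {0..T}"
      then have "1 \<le> exp (4 * lam * s)" using lam_pos by simp
      moreover have "\<bar>fst (law X s) - fst (law Y s)\<bar> \<le> 1" "\<bar>snd (law X s) - snd (law Y s)\<bar> \<le> 1"
        using probabilitiesD(1)[OF p(1)] probabilitiesD(1)[OF p(2)] unfolding unit_valued_def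
        by (smt (verit))+
      ultimately show "\<bar>fst (law X s) - fst (law Y s)\<bar> \<le> (1/2) ^ 0 * exp (4 * lam * s) \<and>
        \<bar>snd (law X s) - snd (law Y s)\<bar> \<le> (1/2) ^ 0 * exp (4 * lam * s)"
        unfolding power_0 mult_1_left by linarith
    qed
  next
    case (Suc n)
    then show ?case
      using law_contraction[OF X Y p, of "(1/2) ^ n"] by simp
  qed
  then have "fst (law X s) = fst (law Y s)" "snd (law X s) = snd (law Y s)"
    using s by (auto intro!: eq_if_geometrically_close[of _ _ "exp (4 * lam * s)"] simp: mult.commute)
  then show ?thesis by (simp add: prod_eq_iff)
qed

text \<open>Picard iteration from the zero function: \<open>P (Suc n)\<close> is the law of the
  process driven by \<open>P n\<close>, and the contraction makes the increments geometric at each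
  time.\<close>

lemma law_fixed_point_exists:
  assumes x0: "x0 \<in> Sigma_K K"
  shows "\<exists>X. driven (law X) x0 X"
proof -
  define P where "P = rec_nat (\<lambda>_. (0, 0)) (\<lambda>_ p. law (process p x0))"
  have P0: "P 0 = (\<lambda>_. (0, 0))" and PS: "P (Suc n) = law (process (P n) x0)" for n
    by (simp_all add: P_def)
  have prob: "probabilities (P n)" for n
  proof (induction n)
    case 0
    show ?case unfolding P0 by (rule probabilitiesI) auto
  next
    case (Suc n)
    then show ?case unfolding PS
      using driven_process[OF Suc x0] by (auto simp: driven_def intro: probabilities_law)
  qed
  let ?e = "\<lambda>s. exp (4 * lam * s)"
  have step: "\<forall>s\<in>{0..T}. \<bar>fst (P (Suc n) s) - fst (P n s)\<bar> \<le> (1/2) ^ n * ?e s \<and>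
     \<bar>snd (P (Suc n) s) - snd (P n s)\<bar> \<le> (1/2) ^ n * ?e s" for n
  proof (induction n)
    case 0
    show ?case
    proof
      fix s assume "s \<in> {0..T}"
      then have "1 \<le> ?e s" using lam_pos by simp
      moreover have "\<bar>fst (P (Suc 0) s) - fst (P 0 s)\<bar> \<le> 1" "\<bar>snd (P (Suc 0) s) - snd (P 0 s)\<bar> \<le> 1"
        using probabilitiesD(1)[OF prob[of "Suc 0"]] unfolding unit_valued_def P0 by auto
      ultimately show "\<bar>fst (P (Suc 0) s) - fst (P 0 s)\<bar> \<le> (1/2) ^ 0 * ?e s \<and>
        \<bar>snd (P (Suc 0) s) - snd (P 0 s)\<bar> \<le> (1/2) ^ 0 * ?e s"
        unfolding power_0 mult_1_left by linarith
    qed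
  next
    case (Suc n)
    then show ?case
      using law_contraction[OF driven_process[OF prob x0] driven_process[OF prob x0] prob prob,
          of "(1/2) ^ n" _ "Suc n" n]
      unfolding PS[symmetric] by simp
  qed
  \<comment> \<open>Convergence is known on \<open>{0..T}\<close> only; \<open>confine\<close> makes
    \<open>q\<close> a limit of measurable functions on the whole line.\<close>
  define q where "q s = (lim (\<lambda>n. fst (P n (confine T s))), lim (\<lambda>n. snd (P n (confine T s))))" for s
  have inc: "\<bar>fst (P (Suc n) (confine T s)) - fst (P n (confine T s))\<bar> \<le> ?e (confine T s) * (1/2) ^ n"
    "\<bar>snd (P (Suc n) (confine T s)) - snd (P n (confine T s))\<bar> \<le> ?e (confine T s) * (1/2) ^ n" for n s
    using step[of n] confine_in[of T s] T_pos by (auto simp: mult.commute)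
  note lim1 = geometric_increments_limit[of "\<lambda>n. fst (P n (confine T s))" for s, OF inc(1)]
  note lim2 = geometric_increments_limit[of "\<lambda>n. snd (P n (confine T s))" for s, OF inc(2)]
  have conv: "(\<lambda>n. fst (P n (confine T s))) \<longlonglongrightarrow> fst (q s)" "(\<lambda>n. snd (P n (confine T s))) \<longlonglongrightarrow> snd (q s)" for s
    using lim1(1) lim2(1) by (simp_all add: q_def convergent_LIMSEQ_iff)
  have confine: "confine T \<in> borel_measurable borel" unfolding confine_def by measurable
  have q: "probabilities q"
  proof -
    have "probabilities (\<lambda>s. (fst (q s), snd (q s)))"
    proof (rule probabilitiesI)
      fix s
      have b: "0 \<le> fst (P n r)" "fst (P n r) \<le> 1" "0 \<le> snd (P n r)" "snd (P n r) \<le> 1" for n r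
        using probabilitiesD(1)[OF prob[of n]] by (auto simp: unit_valued_def)
      show "0 \<le> fst (q s)" by (rule LIMSEQ_le_const[OF conv(1)]) (simp add: b)
      show "fst (q s) \<le> 1" by (rule LIMSEQ_le_const2[OF conv(1)]) (simp add: b)
      show "0 \<le> snd (q s)" by (rule LIMSEQ_le_const[OF conv(2)]) (simp add: b)
      show "snd (q s) \<le> 1" by (rule LIMSEQ_le_const2[OF conv(2)]) (simp add: b)
    next
      show "(\<lambda>s. fst (q s)) \<in> borel_measurable borel"
        by (rule borel_measurable_LIMSEQ_real[OF conv(1)])
          (rule measurable_compose[OF confine probabilitiesD(3)[OF prob]])
      show "(\<lambda>s. snd (q s)) \<in> borel_measurable borel"
        by (rule borel_measurable_LIMSEQ_real[OF conv(2)])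
          (rule measurable_compose[OF confine probabilitiesD(4)[OF prob]])
    qed
    then show ?thesis by simp
  qed
  let ?X = "process q x0"
  have X: "driven q x0 ?X" by (rule driven_process[OF q x0])
  have close: "\<bar>fst (q s) - fst (P n s)\<bar> \<le> 2 * (1/2) ^ n * ?e s"
    "\<bar>snd (q s) - snd (P n s)\<bar> \<le> 2 * (1/2) ^ n * ?e s" if "s \<in> {0..T}" for s n
    using lim1(2)[of n s] lim2(2)[of n s] confine_eq[OF that]
    by (simp_all add: q_def abs_minus_commute mult_ac)
  have fixed: "q s = law ?X s" if s: "s \<in> {0..T}" for s
  proof -
    \<comment> \<open>\<open>close\<close> bounds the distance from \<open>q\<close> to
      \<open>P n\<close> by \<open>2 * (1/2) ^ n\<close>, and one application of the contraction
      halves it, with \<open>P (Suc n)\<close> as the law of the process for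
      \<open>P n\<close>.\<close>
    have c: "\<bar>fst (law ?X s) - fst (P (Suc n) s)\<bar> \<le> (1/2) ^ n * ?e s"
      "\<bar>snd (law ?X s) - snd (P (Suc n) s)\<bar> \<le> (1/2) ^ n * ?e s" for n
      using law_contraction[OF X driven_process[OF prob x0] q prob _ s, of "2 * (1/2) ^ n" n] close
      unfolding PS[symmetric] by simp_all
    \<comment> \<open>Triangle inequality through \<open>P (Suc n)\<close>: \<open>(1/2) ^ n\<close>
      from \<open>c\<close> plus \<open>2 * (1/2) ^ Suc n\<close> from \<open>close\<close>.\<close>
    have d: "\<bar>fst (q s) - fst (law ?X s)\<bar> \<le> (2 * ?e s) * (1/2) ^ n"
      "\<bar>snd (q s) - snd (law ?X s)\<bar> \<le> (2 * ?e s) * (1/2) ^ n" for n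
      using c[of n] close[OF s, of "Suc n"] by (simp_all add: mult.commute)
    have "fst (q s) = fst (law ?X s)" by (rule eq_if_geometrically_close[OF d(1)])
    moreover have "snd (q s) = snd (law ?X s)" by (rule eq_if_geometrically_close[OF d(2)])
    ultimately show ?thesis by (simp add: prod_eq_iff)
  qed
  show ?thesis using driven_cong[OF X fixed] by blast
qed

text \<open>The two laws agree on \<open>{0..T}\<close>, so the bands have width \<open>0\<close>
  and \<open>prob_disagree\<close> applies with \<open>C = 0\<close>.\<close>

lemma driven_law_unique:
  assumes X: "driven (law X) x0 X" and Y: "driven (law Y) x0 Y"
  shows "indistinguishable M T X Y"
proof -
  have p: "probabilities (law X)" "probabilities (law Y)"
    using X Y by (auto simp: driven_def intro: probabilities_law)
  have T: "T \<in> {0..T}" using T_pos by simp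
  have "prob (disagree (law X) (law Y) T) \<le> 0 / 2 * exp (4 * lam * T)"
    using law_fixed_point_unique[OF X Y] by (intro prob_disagree[OF p T]) auto
  then have "prob (disagree (law X) (law Y) T) = 0"
    using measure_nonneg[of M "disagree (law X) (law Y) T"] by simp
  then have "AE \<omega> in M. \<omega> \<notin> disagree (law X) (law Y) T"
    using prob_eq_0[OF disagree_event[OF p order_refl]] by blast
  with driven_agree[OF X Y p T] show ?thesis
    unfolding indistinguishable_def by eventually_elim blast
qed

end

section \<open>Comparison with the integral equations\<close>

text \<open>The set of points counted by an integral of the system, for one fixed path. The
  threshold moves with the path; at an event the slice of this set is a \<open>region\<close> for
  the state just before.\<close>

definition graph_region :: "nat \<Rightarrow> (real \<Rightarrow> real \<times> real) \<Rightarrow> driver \<Rightarrow> (real \<Rightarrow> state) \<Rightarrow> real \<Rightarrow> (real \<times> real) set" where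
  "graph_region K p d f t = {(s, h). s \<in> {0..t} \<and> 0 \<le> h \<and> h \<le> rate K p d (left_lim f s) s}"

lemma graph_region_borel:
  assumes f: "f \<in> cadlag_paths T E" and p: "p \<in> borel_measurable borel" and t: "t \<in> {0..T}"
  shows "graph_region K p d f t \<in> sets borel"
proof -
  have T: "0 \<le> T" using t by simp
  \<comment> \<open>The left limit takes countably many values and is measurable in time, so the
    threshold is composed from the measurable rates of fixed states.\<close>
  have "(\<lambda>s. rate K p d (left_lim f (confine T s)) s) \<in> borel_measurable borel"
    by (rule measurable_compose_countable[where f = "\<lambda>x s. rate K p d x s"])
      (use left_lim_measurable[OF f T] p in auto)
  then have "{(s, h). s \<in> {0..t} \<and> 0 \<le> h \<and> h \<le> rate K p d (left_lim f (confine T s)) s} \<in> sets borel"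
    by (rule subgraph_borel) simp
  also have "{(s, h). s \<in> {0..t} \<and> 0 \<le> h \<and> h \<le> rate K p d (left_lim f (confine T s)) s} = graph_region K p d f t"
    using t by (auto simp: graph_region_def confine_eq)
  finally show ?thesis .
qed

text \<open>The slice at time \<open>0\<close> is discarded by \<open>zero\<close>, and
  \<open>cnt_decomp\<close> reduces the rest to the events; the result is the sum that occurs in
  \<open>flow\<close>.\<close>

lemma (in configuration) cnt_graph_region:
  assumes f: "f \<in> cadlag_paths T (Sigma_K K)" and p: "unit_valued p" "p \<in> borel_measurable borel"
    and t: "t \<in> {0..T}" and d: "d \<in> active K" and zero: "cnt d ({0} \<times> {0..real K}) = 0"
  shows "graph_region K p d f t \<subseteq> box"
    and "cnt d (graph_region K p d f t) = (\<Sum>s\<in>events \<inter> {..t}. cnt d (region K p d (left_lim f s) {s}))"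
proof -
  let ?G = "graph_region K p d f t"
  note G = graph_region_borel[OF f p(2) t, of K d]
  show sub: "?G \<subseteq> box"
  proof safe
    fix s h assume "(s, h) \<in> ?G"
    then have "s \<in> {0..t}" "0 \<le> h" "h \<le> rate K p d (left_lim f s) s" by (auto simp: graph_region_def)
    moreover have "left_lim f s \<in> Sigma_K K" if "s \<in> {0..T}" using left_lim_in[OF f that] .
    ultimately show "s \<in> {0..T}" "h \<in> {0..real K}"
      using t rate_le[OF p(1) K_pos, of "left_lim f s" d s] by auto
  qed
  let ?H = "?G \<inter> {0<..} \<times> UNIV"
  have H: "?H \<in> sets borel" using G by (intro sets.Int) simp_all
  have Hsub: "?H \<subseteq> {0<..T} \<times> {0..real K}" using sub by fastforce
  have "?H \<subseteq> box" using sub by blast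
  moreover have "?G - ?H \<subseteq> {0} \<times> {0..real K}"
  proof
    fix v assume v: "v \<in> ?G - ?H"
    then have "v \<in> box" "0 \<le> fst v" "\<not> 0 < fst v" using sub by (auto simp: graph_region_def)
    then show "v \<in> {0} \<times> {0..real K}" by (cases v) auto
  qed
  ultimately have "cnt d ?G = cnt d ?H"
    using t zero by (intro cnt_eq_up_to_null[OF d G sub H, of "{0} \<times> {0..real K}"]) auto
  also have "\<dots> = (\<Sum>s\<in>events. cnt d (?H \<inter> {s} \<times> UNIV))" by (rule cnt_decomp[OF d H Hsub])
  also have "\<dots> = (\<Sum>s\<in>events. if s \<in> {..t} then cnt d (region K p d (left_lim f s) {s}) else 0)"
  proof (rule sum.cong[OF refl])
    fix s assume "s \<in> events"
    then have "s > 0" using events_subset by auto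
    then have "?H \<inter> {s} \<times> UNIV = (if s \<in> {..t} then region K p d (left_lim f s) {s} else {})"
      by (auto simp: graph_region_def region_def)
    then show "cnt d (?H \<inter> {s} \<times> UNIV) = (if s \<in> {..t} then cnt d (region K p d (left_lim f s) {s}) else 0)"
      by simp
  qed
  also have "\<dots> = (\<Sum>s\<in>events \<inter> {..t}. cnt d (region K p d (left_lim f s) {s}))"
    by (rule sum.inter_restrict[symmetric]) simp
  finally show "cnt d ?G = (\<Sum>s\<in>events \<inter> {..t}. cnt d (region K p d (left_lim f s) {s}))" .
qed

context mean_field_system
begin

section \<open>The integrals of the system as counts of points\<close>

lemma measure_points:
  assumes "\<omega> \<in> space M" "d \<in> active K" "B \<in> sets borel" "B \<subseteq> box"
  shows "measure (Q d \<omega>) B = real (points \<omega> d B)"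
  using configuration.measure_cnt[OF configuration[OF assms(1)] assms(2-)] .

lemma thinned_count_eq:
  assumes N: "emeasure (N \<omega>) (graph_region K p d f t) = emeasure (Q d \<omega>) (graph_region K p d f t)"
    and sp: "space (N \<omega>) = quadrant"
    and rate: "\<And>s. s \<in> {0..t} \<Longrightarrow> \<theta> s = rate K p d (left_lim f s) s"
  shows "thinned_count (N \<omega>) \<theta> t = measure (Q d \<omega>) (graph_region K p d f t)"
proof -
  let ?G = "graph_region K p d f t"
  have "(\<lambda>v. indicat_real ({0..t} \<times> {0..}) v *\<^sub>R (case v of (s, h) \<Rightarrow> of_bool (0 \<le> h \<and> h \<le> \<theta> s))) = indicat_real ?G"
    using rate by (auto simp: fun_eq_iff indicator_def graph_region_def)
  then have "thinned_count (N \<omega>) \<theta> t = measure (N \<omega>) (?G \<inter> space (N \<omega>))"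
    unfolding thinned_count_def set_lebesgue_integral_def by simp
  also have "?G \<inter> space (N \<omega>) = ?G" using sp by (auto simp: graph_region_def)
  finally show ?thesis using N by (simp add: measure_def)
qed

text \<open>Left limits stay in \<open>Sigma_K K\<close>, so terms with \<open>l > K\<close> vanish
  and the series is a finite sum. Each remaining integral counts the trace of the graph region at
  height \<open>1\<close>.\<close>

lemma server_count_eq:
  assumes \<omega>: "\<omega> \<in> space M" and f: "f \<in> cadlag_paths T (Sigma_K K)"
    and p: "p \<in> borel_measurable borel" and t: "t \<in> {0..T}"
    and rho: "\<And>s. s \<in> {0..t} \<Longrightarrow> \<rho> s = fst (snd (left_lim f s))"
  shows "server_count (\<lambda>l. Nmu l \<omega>) \<rho> t = (\<Sum>l=1..K. measure (Q (Mu l) \<omega>) (graph_region K p (Mu l) f t))"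
proof -
  have rate: "rate K p (Mu l) x s = of_bool (l \<le> fst (snd x))" for l x s by (cases x) simp
  have summand: "set_lebesgue_integral (Nmu l \<omega>) {0..t} (\<lambda>s. of_bool (l \<le> \<rho> s)) =
    measure (Q (Mu l) \<omega>) (graph_region K p (Mu l) f t)" if l: "l \<ge> 1" for l
  proof -
    let ?G = "graph_region K p (Mu l) f t"
    let ?L = "{s. (s, 1) \<in> ?G}"
    have "(\<lambda>s. indicat_real {0..t} s *\<^sub>R of_bool (l \<le> \<rho> s)) = indicat_real ?L"
      using rho by (auto simp: fun_eq_iff indicator_def graph_region_def rate)
    then have "set_lebesgue_integral (Nmu l \<omega>) {0..t} (\<lambda>s. of_bool (l \<le> \<rho> s)) =
      measure (Nmu l \<omega>) (?L \<inter> space (Nmu l \<omega>))"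
      unfolding set_lebesgue_integral_def by simp
    also have "\<dots> = measure (Q (Mu l) \<omega>) ?G"
      using Q_linear[OF \<omega> graph_region_borel[OF f p t] l] space_linear[OF pp_Mu[OF l] \<omega>]
      by (simp add: measure_def del: Q.simps)
    finally show ?thesis .
  qed
  have zero: "set_lebesgue_integral (Nmu l \<omega>) {0..t} (\<lambda>s. of_bool (l \<le> \<rho> s)) = (0::real)" if "l > K" for l
  proof -
    have "fst (snd (left_lim f s)) \<le> K" if "s \<in> {0..t}" for s
      using left_lim_in[OF f, of s] that t by (auto simp: Sigma_K_def)
    then have "\<not> l \<le> \<rho> s" if "s \<in> {0..t}" for s
      using rho[OF that] that \<open>l > K\<close> by fastforce
    then have "(\<lambda>s. indicat_real {0..t} s *\<^sub>R of_bool (l \<le> \<rho> s)) = (\<lambda>_. 0::real)"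
      by (auto simp: fun_eq_iff indicator_def)
    then show ?thesis unfolding set_lebesgue_integral_def by simp
  qed
  have "server_count (\<lambda>l. Nmu l \<omega>) \<rho> t =
    infsum (\<lambda>l. set_lebesgue_integral (Nmu l \<omega>) {0..t} (\<lambda>s. of_bool (l \<le> \<rho> s))) {1..K}"
    unfolding server_count_def by (rule infsum_cong_neutral) (auto intro: zero)
  also have "\<dots> = (\<Sum>l=1..K. measure (Q (Mu l) \<omega>) (graph_region K p (Mu l) f t))"
    by (simp add: infsum_finite del: Q.simps) (intro sum.cong refl summand, simp)
  finally show ?thesis .
qed

text \<open>Once every integral is the real value of a natural number, the equations with
  subtraction and the subtraction-free \<open>balance\<close> differ by rearrangement. The
  thresholds are left abstract so that they can be matched with those of the system.\<close>

lemma equations_iff_balance: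
  assumes \<omega>: "\<omega> \<in> space M" and zero: "\<forall>d\<in>active K. points \<omega> d ({0} \<times> {0..real K}) = 0"
    and f: "f \<in> cadlag_paths T (Sigma_K K)" and p: "probabilities p" and t: "t \<in> {0..T}"
    and \<theta>: "\<And>d s. s \<in> {0..T} \<Longrightarrow> \<theta> d s = rate K p d (left_lim f s) s"
    and \<rho>: "\<And>s. s \<in> {0..T} \<Longrightarrow> \<rho> s = fst (snd (left_lim f s))"
  shows "(real (fst (f t)) = real w + thinned_count (Nlam 1 \<omega>) (\<theta> (Lam 1)) t - thinned_count (Nnu 1 \<omega>) (\<theta> (Nu 1)) t \<and>
     real (fst (snd (f t))) = real x + thinned_count (Nnu 1 \<omega>) (\<theta> (Nu 1)) t - server_count (\<lambda>l. Nmu l \<omega>) \<rho> t \<and>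
     real (fst (snd (snd (f t)))) = real y + server_count (\<lambda>l. Nmu l \<omega>) \<rho> t - thinned_count (Nlam 2 \<omega>) (\<theta> (Lam 2)) t \<and>
     real (snd (snd (snd (f t)))) = real z + thinned_count (Nlam 2 \<omega>) (\<theta> (Lam 2)) t - thinned_count (Nnu 2 \<omega>) (\<theta> (Nu 2)) t)
    \<longleftrightarrow> balance K (w, x, y, z) (\<lambda>d. \<Sum>s\<in>configuration.events (\<lambda>d. Q d \<omega>) K T \<inter> {..t}.
          points \<omega> d (region K p d (left_lim f s) {s})) (f t)"
proof -
  interpret cf: configuration "\<lambda>d. Q d \<omega>" K T by (rule configuration[OF \<omega>])
  define c where "c d = (\<Sum>s\<in>cf.events \<inter> {..t}. points \<omega> d (region K p d (left_lim f s) {s}))" for d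
  have G: "graph_region K p d f t \<in> sets borel" for d
    by (rule graph_region_borel[OF f probabilitiesD(2)[OF p] t])
  have Gq: "graph_region K p d f t \<inter> quadrant = graph_region K p d f t" for d
    by (auto simp: graph_region_def)
  have c: "measure (Q d \<omega>) (graph_region K p d f t) = real (c d)" if d: "d \<in> active K" for d
    using cf.cnt_graph_region[OF f probabilitiesD(1,2)[OF p] t d] zero d measure_points[OF \<omega> d G]
    by (simp add: c_def)
  have act: "Lam 1 \<in> active K" "Lam 2 \<in> active K" "Nu 1 \<in> active K" "Nu 2 \<in> active K"
    by (auto simp: active_def)
  have \<theta>t: "\<theta> d s = rate K p d (left_lim f s) s" if "s \<in> {0..t}" for d s
    using \<theta> that t by auto
  have lam_count: "thinned_count (Nlam i \<omega>) (\<theta> (Lam i)) t = real (c (Lam i))"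
    if "i \<in> {1, 2}" "Lam i \<in> active K" for i
    using thinned_count_eq[of "Nlam i" \<omega> p "Lam i" f t, OF _ space_planar[OF pp_Lam[OF that(1)] \<omega>] \<theta>t]
      Q_planar(1)[OF \<omega> G[of "Lam i"] that(1)] Gq c[OF that(2)] by simp
  have nu_count: "thinned_count (Nnu i \<omega>) (\<theta> (Nu i)) t = real (c (Nu i))"
    if "i \<in> {1, 2}" "Nu i \<in> active K" for i
    using thinned_count_eq[of "Nnu i" \<omega> p "Nu i" f t, OF _ space_planar[OF pp_Nu[OF that(1)] \<omega>] \<theta>t]
      Q_planar(2)[OF \<omega> G[of "Nu i"] that(1)] Gq c[OF that(2)] by simp
  have "server_count (\<lambda>l. Nmu l \<omega>) \<rho> t = (\<Sum>l=1..K. measure (Q (Mu l) \<omega>) (graph_region K p (Mu l) f t))"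
    using \<rho> t by (intro server_count_eq[OF \<omega> f probabilitiesD(2)[OF p] t]) auto
  also have "\<dots> = (\<Sum>l=1..K. real (c (Mu l)))"
    by (intro sum.cong refl c) (auto simp: active_def)
  finally have server: "server_count (\<lambda>l. Nmu l \<omega>) \<rho> t = real (\<Sum>l=1..K. c (Mu l))" by simp
  have counts: "thinned_count (Nlam 1 \<omega>) (\<theta> (Lam 1)) t = real (c (Lam 1))"
    "thinned_count (Nlam 2 \<omega>) (\<theta> (Lam 2)) t = real (c (Lam 2))"
    "thinned_count (Nnu 1 \<omega>) (\<theta> (Nu 1)) t = real (c (Nu 1))"
    "thinned_count (Nnu 2 \<omega>) (\<theta> (Nu 2)) t = real (c (Nu 2))"
    using lam_count[OF _ act(1)] lam_count[OF _ act(2)] nu_count[OF _ act(3)] nu_count[OF _ act(4)] by blast+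
  define m where "m = (\<Sum>l=1..K. c (Mu l))"
  obtain w' x' y' z' where ft: "f t = (w', x', y', z')" by (cases "f t")
  show ?thesis
    unfolding c_def[symmetric] ft balance.simps fst_conv snd_conv server counts m_def[symmetric]
    by (intro iffI conjI; elim conjE; linarith)
qed

text \<open>The probabilities in the system are the two components of \<open>law X\<close> on
  \<open>{0..T}\<close>. Off the null event of a point at time \<open>0\<close>, the equations and
  the flow condition are equivalent path by path.\<close>

lemma is_solution_iff_driven:
  "is_solution M Nlam Nnu Nmu K T x0 X \<longleftrightarrow> driven (law X) x0 X"
proof (cases "admissible X")
  case True
  obtain w x y z where x0: "x0 = (w, x, y, z)" by (cases x0)
  let ?S = "\<lambda>v :: state. fst v + fst (snd v) + fst (snd (snd v)) + snd (snd (snd v))"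
  define V' where "V' \<omega> = left_lim (\<lambda>u. fst (snd (snd (X u \<omega>))))" for \<omega>
  define S' where "S' \<omega> = left_lim (\<lambda>u. ?S (X u \<omega>))" for \<omega>
  define pV where "pV s = prob {\<omega> \<in> space M. V' \<omega> s > 0}" for s
  define pS where "pS s = prob {\<omega> \<in> space M. S' \<omega> s < K}" for s
  note map = left_lim_map[OF admissibleD(2)[OF True]]
  have V': "V' \<omega> s = fst (snd (snd (left_lim (\<lambda>u. X u \<omega>) s)))"
    and S': "S' \<omega> s = ?S (left_lim (\<lambda>u. X u \<omega>) s)" if "\<omega> \<in> space M" "s \<in> {0..T}" for \<omega> s
    using map[OF that] by (simp_all add: V'_def S'_def)
  have law: "law X s = (pV s, pS s)" if s: "s \<in> {0..T}" for s
  proof -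
    have "{\<omega> \<in> space M. left_lim (\<lambda>u. X u \<omega>) s \<in> busy} = {\<omega> \<in> space M. V' \<omega> s > 0}"
      "{\<omega> \<in> space M. left_lim (\<lambda>u. X u \<omega>) s \<in> nonfull K} = {\<omega> \<in> space M. S' \<omega> s < K}"
      using V' S' s by (auto simp: busy_def nonfull_def case_prod_unfold)
    then show ?thesis by (simp add: law_def confine_eq[OF s] pV_def pS_def)
  qed
  \<comment> \<open>The case distinctions stand outside the functions of \<open>s\<close>, so that
    unfolding for a fixed driver yields literally the thresholds written in
    \<open>solves_system\<close>.\<close>
  define \<theta> where "\<theta> \<omega> d = (case d of
      Lam i \<Rightarrow> (if i = 1 then (\<lambda>s. of_bool (S' \<omega> s < K) * pV s) else (\<lambda>s. of_bool (V' \<omega> s > 0) * pS s))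
    | Nu i \<Rightarrow> (if i = 1 then (\<lambda>s. real (left_lim (\<lambda>u. fst (X u \<omega>)) s))
        else (\<lambda>s. real (left_lim (\<lambda>u. snd (snd (snd (X u \<omega>)))) s)))
    | Mu l \<Rightarrow> (\<lambda>s. of_bool (l \<le> left_lim (\<lambda>u. fst (snd (X u \<omega>))) s)))" for \<omega> d
  have \<theta>: "\<theta> \<omega> d s = rate K (law X) d (left_lim (\<lambda>u. X u \<omega>) s) s" if "\<omega> \<in> space M" "s \<in> {0..T}" for \<omega> d s
    using map[OF that, of fst] map[OF that, of "\<lambda>v. fst (snd v)"] map[OF that, of "\<lambda>v. snd (snd (snd v))"]
      V'[OF that] S'[OF that] law[OF that(2)]
    by (cases "left_lim (\<lambda>u. X u \<omega>) s"; cases d) (simp_all add: \<theta>_def)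
  have eq: "AE \<omega> in M. (\<forall>t\<in>{0..T}.
      real (fst (X t \<omega>)) = real w + thinned_count (Nlam 1 \<omega>) (\<theta> \<omega> (Lam 1)) t - thinned_count (Nnu 1 \<omega>) (\<theta> \<omega> (Nu 1)) t \<and>
      real (fst (snd (X t \<omega>))) = real x + thinned_count (Nnu 1 \<omega>) (\<theta> \<omega> (Nu 1)) t
        - server_count (\<lambda>l. Nmu l \<omega>) (left_lim (\<lambda>u. fst (snd (X u \<omega>)))) t \<and>
      real (fst (snd (snd (X t \<omega>)))) = real y + server_count (\<lambda>l. Nmu l \<omega>) (left_lim (\<lambda>u. fst (snd (X u \<omega>)))) t
        - thinned_count (Nlam 2 \<omega>) (\<theta> \<omega> (Lam 2)) t \<and>
      real (snd (snd (snd (X t \<omega>)))) = real z + thinned_count (Nlam 2 \<omega>) (\<theta> \<omega> (Lam 2)) t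
        - thinned_count (Nnu 2 \<omega>) (\<theta> \<omega> (Nu 2)) t)
    \<longleftrightarrow> configuration.flow (\<lambda>d. Q d \<omega>) K T (law X) x0 (\<lambda>t. X t \<omega>)"
    using AE_space AE_no_point_at_0
  proof eventually_elim
    case (elim \<omega>)
    show ?case
      unfolding configuration.flow_def[OF configuration[OF elim(1)]] x0
      by (rule ball_cong[OF refl],
          rule equations_iff_balance[OF elim admissibleD(2)[OF True elim(1)] probabilities_law[OF True]])
        (use \<theta>[OF elim(1)] map[OF elim(1), of _ "\<lambda>v. fst (snd v)"] in auto)
  qed
  have "solves_system M Nlam Nnu Nmu K T x0 (\<lambda>t \<omega>. fst (X t \<omega>)) (\<lambda>t \<omega>. fst (snd (X t \<omega>)))
       (\<lambda>t \<omega>. fst (snd (snd (X t \<omega>)))) (\<lambda>t \<omega>. snd (snd (snd (X t \<omega>))))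
    \<longleftrightarrow> (AE \<omega> in M. configuration.flow (\<lambda>d. Q d \<omega>) K T (law X) x0 (\<lambda>t. X t \<omega>))"
    unfolding eventually_subst[OF eq, symmetric]
    by (simp add: solves_system_def x0 \<theta>_def V'_def S'_def pV_def pS_def Let_def)
  then show ?thesis using True by (simp add: is_solution_def driven_def admissible_def)
qed (auto simp: is_solution_def driven_def admissible_def)

end

theorem theorem1:
  fixes M :: "'w measure"
    and Nlam Nnu :: "nat \<Rightarrow> 'w \<Rightarrow> (real \<times> real) measure"
    and Nmu :: "nat \<Rightarrow> 'w \<Rightarrow> real measure"
    and lam mu nu T :: real and K :: nat
  assumes "prob_space M"
    and "lam > 0" and "mu > 0" and "nu > 0" and "K \<ge> 1" and "T > 0"
    and "driving_processes M Nlam Nnu Nmu lam nu mu"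
  shows "\<forall>init\<in>Sigma_K K.
    (\<exists>X. is_solution M Nlam Nnu Nmu K T init X) \<and>
    (\<forall>X Y. is_solution M Nlam Nnu Nmu K T init X \<longrightarrow>
           is_solution M Nlam Nnu Nmu K T init Y \<longrightarrow> indistinguishable M T X Y)"
proof -
  interpret mean_field_system M Nlam Nnu Nmu lam mu nu T K
    using assms by (intro mean_field_system.intro mean_field_system_axioms.intro)
  show ?thesis
    unfolding is_solution_iff_driven using law_fixed_point_exists driven_law_unique by blast
qed

end
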